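(* Let $\mathcal{Q}$ be the class of all plane quadrangulations, where parallel edges are allowed. Every element of $\mathcal{Q}$ can be obtained from the path graph on 3 vertices (embedded in the sphere) by a finite sequence of applications of the extensions $D_1$, $P_0$ and $P_1$. That is, the extensions $D_1$, $P_0$, $P_1$ generate $\mathcal{Q}$ from the path graph with 3 vertices.
   Context: A map is a connected multigraph 2-cell embedded in a closed orientable surface; it is plane if the surface is the sphere. The size of a face is the number of directed edges in its boundary walk (so an edge with both sides on the same face counts twice). A quadrangulation is a map in which every face has size 4; plane quadrangulations are bipartite, so they have no loops, but parallel edges are allowed. The path graph on 3 vertices embedded in the sphere is a plane quadrangulation with a single face of size 4. The extensions (each maps a plane quadrangulation to a plane quadrangulation with one more vertex; in each, all vertices and edges named are distinct): $D_1$: take an edge $e=uw$; add a new edge parallel to $e$, embedded next to $e$ so that $e$ and the new edge bound a new face of size 2, and place a new vertex $v$ inside this face, joined by a single edge to $u$ only (creating the face with boundary walk $u,v,u,w$). $P_0$: take a face with boundary walk $a,b,c,d$; add a new vertex $v$ inside it joined to $a$ and to $c$. $P_1$: take two faces with boundary walks $a,x,c,z$ and $x,b,y,c$ sharing the edge $xc$; delete the edge $xc$ and place a new vertex $v$ inside the resulting face $a,x,b,y,c,z$, joined to $a$, $b$ and $c$. A set of extensions generates a class of maps from a set of base maps if every map in the class can be obtained by repeatedly applying extensions from the set to one of the base maps.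
   Formalization: In P_0 only a and c must be distinct; b = d (and the edges ab = ad, bc = cd) is allowed, since otherwise P_0 could not be applied to the only face a,b,c,b of the path and the 4-cycle would never be generated. *)

theory Defs
  imports "HOL-Combinatorics.Combinatorics"
begin

(* A map on a closed oriented surface is given by its directed edges (darts), the involution
   opp reversing a dart, and the permutation rot taking a dart to the next one in clockwise
   order around its origin.  Vertices, edges and faces are the orbits of rot, opp and
   rot o opp.  The single-vertex map has no darts and is not represented; it is not a
   quadrangulation. *)

record 'd cmap =
  darts :: "'d set"
  opp :: "'d \<Rightarrow> 'd"
  rot :: "'d \<Rightarrow> 'd"

(* The dart following d on the boundary walk of the face to the left of d. *)
definition fnext :: "'d cmap \<Rightarrow> 'd \<Rightarrow> 'd" where
  "fnext M d = rot M (opp M d)"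

(* The origin of d. *)
definition vert :: "'d cmap \<Rightarrow> 'd \<Rightarrow> 'd set" where
  "vert M d = orbit (rot M) d"

definition edge :: "'d cmap \<Rightarrow> 'd \<Rightarrow> 'd set" where
  "edge M d = orbit (opp M) d"

definition face :: "'d cmap \<Rightarrow> 'd \<Rightarrow> 'd set" where
  "face M d = orbit (fnext M) d"

definition vertices :: "'d cmap \<Rightarrow> 'd set set" where
  "vertices M = vert M ` darts M"

definition edges :: "'d cmap \<Rightarrow> 'd set set" where
  "edges M = edge M ` darts M"

definition faces :: "'d cmap \<Rightarrow> 'd set set" where
  "faces M = face M ` darts M"

definition connected_map :: "'d cmap \<Rightarrow> bool" where
  "connected_map M \<longleftrightarrow>
     (\<forall>x\<in>darts M. \<forall>y\<in>darts M. (\<lambda>p q. q = opp M p \<or> q = rot M p)\<^sup>*\<^sup>* x y)"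

definition is_map :: "'d cmap \<Rightarrow> bool" where
  "is_map M \<longleftrightarrow>
     finite (darts M) \<and> opp M permutes darts M \<and> rot M permutes darts M \<and>
     (\<forall>d\<in>darts M. opp M d \<noteq> d \<and> opp M (opp M d) = d) \<and>
     connected_map M"

(* Genus 0, by Euler's formula. *)
definition plane :: "'d cmap \<Rightarrow> bool" where
  "plane M \<longleftrightarrow> card (vertices M) + card (faces M) = card (edges M) + 2"

definition plane_quadrangulation :: "'d cmap \<Rightarrow> bool" where
  "plane_quadrangulation M \<longleftrightarrow> is_map M \<and> plane M \<and> (\<forall>F\<in>faces M. card F = 4)"

definition map_iso :: "'d cmap \<Rightarrow> 'e cmap \<Rightarrow> bool" where
  "map_iso M N \<longleftrightarrow>
     (\<exists>h. bij_betw h (darts M) (darts N) \<and>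
          (\<forall>d\<in>darts M. h (opp M d) = opp N (h d) \<and> h (rot M d) = rot N (h d)))"

(* The corner of a face at the origin of its dart f lies just before f in the rotation, so a
   new dart is placed in that corner by inserting it before f.  The operations below are
   meant for new darts d, d' outside darts M. *)

(* Put a new vertex in the corner of f and join it to the origin of f by the edge {d, d'};
   d' is the dart leaving the new vertex. *)
definition add_leaf :: "'d \<Rightarrow> 'd \<Rightarrow> 'd \<Rightarrow> 'd cmap \<Rightarrow> 'd cmap" where
  "add_leaf f d d' M =
     \<lparr>darts = {d, d'} \<union> darts M,
      opp = (opp M)(d := d', d' := d),
      rot = (\<lambda>x. if x = d then f else if x = d' then d'
                  else if rot M x = f then d else rot M x)\<rparr>"

(* Join two distinct corners f, g of one face by a new edge with dart d leaving the origin of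
   f and d' leaving the origin of g.  Afterwards the face walks are d, g, ..., (pred f) and
   d', f, ..., (pred g), where pred is the predecessor on the old face walk. *)
definition add_edge :: "'d \<Rightarrow> 'd \<Rightarrow> 'd \<Rightarrow> 'd \<Rightarrow> 'd cmap \<Rightarrow> 'd cmap" where
  "add_edge f g d d' M =
     \<lparr>darts = {d, d'} \<union> darts M,
      opp = (opp M)(d := d', d' := d),
      rot = (\<lambda>x. if x = d then f else if x = d' then g
                  else if rot M x = f then d else if rot M x = g then d' else rot M x)\<rparr>"

(* Delete the edge of e, assumed not to be a loop and to have no endpoint of degree 1. *)
definition del_edge :: "'d \<Rightarrow> 'd cmap \<Rightarrow> 'd cmap" where
  "del_edge e M =
     \<lparr>darts = darts M - {e, opp M e},
      opp = (\<lambda>x. if x \<in> {e, opp M e} then x else opp M x),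
      rot = (\<lambda>x. if x \<in> {e, opp M e} then x
                  else if rot M x = e then rot M e
                  else if rot M x = opp M e then rot M (opp M e) else rot M x)\<rparr>"

(* The dart p goes from u to w.  The new parallel edge {d, d'} is drawn to the left of p, so
   that the new face of size 2 has walk d', p; the new vertex v is then put into its corner
   at u.  Drawing the parallel edge on the other side gives an isomorphic result, the two
   parallel edges exchanging roles. *)
definition ext_D1 :: "'d cmap \<Rightarrow> 'd cmap \<Rightarrow> bool" where
  "ext_D1 M M' \<longleftrightarrow> plane_quadrangulation M \<and>
     (\<exists>p\<in>darts M. \<exists>d d' k k'.
        distinct [d, d', k, k'] \<and> {d, d', k, k'} \<inter> darts M = {} \<and>
        M' = add_leaf p k k' (add_edge p (fnext M p) d d' M))"

(* The dart f is ab, so fnext M (fnext M f) is cd.  The new edges are {k, k'} = av and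
   {l, l'} = vc.  The vertices a and c must be distinct, but b and d may coincide: the only
   face of the path a, b, c has boundary walk a, b, c, b, and P0 applied to it gives the
   4-cycle, which arises in no other way. *)
definition ext_P0 :: "'d cmap \<Rightarrow> 'd cmap \<Rightarrow> bool" where
  "ext_P0 M M' \<longleftrightarrow> plane_quadrangulation M \<and>
     (\<exists>f\<in>darts M. \<exists>k k' l l'.
        (let g = fnext M (fnext M f) in
           vert M f \<noteq> vert M g \<and>
           distinct [k, k', l, l'] \<and> {k, k', l, l'} \<inter> darts M = {} \<and>
           M' = add_edge k' g l l' (add_leaf f k k' M)))"

(* The face walks are a, x, c, z (darts ax, xc, cz, za) and x, b, y, c (darts xb, by, yc, cx),
   where cx is the reverse of xc.  The new edges are {k, k'} = av, {l, l'} = vb and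
   {m, m'} = vc.  Both ways of joining v to alternate vertices of the hexagon arise, as xc
   may be either dart of its edge. *)
definition ext_P1 :: "'d cmap \<Rightarrow> 'd cmap \<Rightarrow> bool" where
  "ext_P1 M M' \<longleftrightarrow> plane_quadrangulation M \<and>
     (\<exists>xc\<in>darts M. \<exists>k k' l l' m m'.
        (let cz = fnext M xc; za = fnext M cz; ax = fnext M za;
             xb = fnext M (opp M xc); by = fnext M xb; yc = fnext M by
         in distinct [vert M ax, vert M xb, vert M by, vert M yc, vert M cz, vert M za] \<and>
            distinct [k, k', l, l', m, m'] \<and> {k, k', l, l', m, m'} \<inter> darts M = {} \<and>
            M' = add_edge l cz m m' (add_edge k' by l l' (add_leaf ax k k' (del_edge xc M)))))"

(* The path a - b - c with darts 0 = ab, 1 = ba, 2 = bc, 3 = cb. *)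
definition path3 :: "nat cmap" where
  "path3 = \<lparr>darts = {0, 1, 2, 3},
            opp = transpose 0 1 \<circ> transpose 2 3,
            rot = transpose 1 2\<rparr>"

(* The class C may use any type of darts; the construction takes place on the dart type of
   the base maps, and its result is compared with the given map up to orientation-preserving
   isomorphism. *)
definition generates ::
    "('d cmap \<Rightarrow> 'd cmap \<Rightarrow> bool) set \<Rightarrow> 'd cmap set \<Rightarrow> 'e cmap set \<Rightarrow> bool" where
  "generates Ext Base C \<longleftrightarrow>
     (\<forall>M\<in>C. \<exists>B\<in>Base. \<exists>N. (\<lambda>X Y. \<exists>E\<in>Ext. E X Y)\<^sup>*\<^sup>* B N \<and> map_iso N M)"

end

(* By Euler's inequality V + F <= E + 2 for connected maps, slitting a plane quadrangulation along a
   pair of parallel edges separates it, and each side closes up to a smaller plane quadrangulation.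
   Hence one finds, by induction and away from the ends of any prescribed edge, a vertex that is a
   leaf, or has degree 2 and two distinct neighbours, or has degree 3 and lies inside a hexagon of
   six distinct vertices. The base of the induction is a quadrangulation without parallel edges,
   where the excess sum of 4 - deg over all vertices is 8; the ends of the prescribed edge, together
   with the vertices of degree 3 that fail to be reducible because of a neighbour of degree 2,
   account for at most 6. Such a vertex is removed by undoing D1, P0 or P1, respectively, until a
   single face is left. *)
theory Submission
  imports Defs
begin

subsection \<open>Orbits of permutations\<close>

lemma permutes_permutation: "f permutes D \<Longrightarrow> finite D \<Longrightarrow> permutation f"
  by (auto simp: permutation_permutes)

lemma orbit_eqI_mem:
  assumes "permutation f" "y \<in> orbit f x"
  shows "orbit f y = orbit f x"
  by (meson assms cyclic_on_orbit' orbit_cyclic_eq3)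

lemma orbit_eq_iff:
  assumes "permutation f"
  shows "orbit f y = orbit f x \<longleftrightarrow> y \<in> orbit f x"
  using assms orbit_eqI_mem permutation_self_in_orbit by metis

lemma orbit_disjoint:
  assumes "permutation f" "y \<notin> orbit f x"
  shows "orbit f y \<inter> orbit f x = {}"
  using assms orbit_eqI_mem permutation_self_in_orbit by (metis disjoint_iff)

lemma orbit_subsetI:
  assumes "x \<in> X" "\<And>y. y \<in> X \<Longrightarrow> f y \<in> X"
  shows "orbit f x \<subseteq> X"
proof
  fix y assume "y \<in> orbit f x" then show "y \<in> X"
    by induction (use assms in auto)
qed

lemma permutation_preimage_in_orbit:
  assumes "permutation f" "f x \<in> orbit f y"
  shows "x \<in> orbit f y"
  by (metis assms orbit_eqI_mem permutation_orbit_step permutation_self_in_orbit)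

lemma orbit_transpose_other:
  assumes f: "permutation f" and "a \<notin> orbit f x" "b \<notin> orbit f x"
  shows "orbit (f \<circ> transpose a b) x = orbit f x"
  by (rule orbit_cong[OF permutation_self_in_orbit[OF f]])
    (use assms in \<open>auto simp: transpose_def\<close>)

lemma orbit_transpose_sub:
  assumes f: "permutation f" and b: "b \<notin> orbit f a"
  shows "orbit f a \<subseteq> orbit (f \<circ> transpose a b) b"
proof
  let ?g = "f \<circ> transpose a b"
  fix y assume "y \<in> orbit f a"
  then show "y \<in> orbit ?g b"
  proof induction
    case base
    show ?case by (rule orbit_eqI(1)) simp
  next
    case (step y)
    show ?case
    proof (cases "y = a")
      case True then show ?thesis by (intro orbit_eqI(1)) simp
    next
      case False
      moreover have "y \<noteq> b" using step b by auto
      ultimately have "f y = ?g y" by (simp add: transpose_def)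
      then show ?thesis using step by (auto intro: orbit_eqI(2))
    qed
  qed
qed

lemma orbit_transpose_merge:
  assumes f: "permutation f" and b: "b \<notin> orbit f a"
    and x: "x \<in> orbit f a \<union> orbit f b"
  shows "orbit (f \<circ> transpose a b) x = orbit f a \<union> orbit f b"
proof -
  let ?g = "f \<circ> transpose a b"
  have g: "permutation ?g" by (simp add: f permutation_compose permutation_swap_id)
  have a: "a \<notin> orbit f b" using b f by (metis orbit_swap permutation_self_in_orbit)
  have 1: "orbit f a \<subseteq> orbit ?g b" by (rule orbit_transpose_sub[OF f b])
  have 2: "orbit f b \<subseteq> orbit ?g a"
    using orbit_transpose_sub[OF f a] by (simp add: transpose_commute)
  have "a \<in> orbit ?g b" using 1 f permutation_self_in_orbit by fast
  then have eq: "orbit ?g a = orbit ?g b" by (rule orbit_eqI_mem[OF g])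
  have "orbit ?g a \<subseteq> orbit f a \<union> orbit f b"
    by (rule orbit_subsetI)
      (auto simp: transpose_def permutation_self_in_orbit[OF f] orbit.base intro: orbit.step)
  with 1 2 eq have ga: "orbit ?g a = orbit f a \<union> orbit f b" by blast
  with x have "x \<in> orbit ?g a" by simp
  from orbit_eqI_mem[OF g this] ga show ?thesis by simp
qed

lemma orbit_transpose_split:
  assumes f: "permutation f" and b: "b \<in> orbit f a" and "a \<noteq> b"
  shows "b \<notin> orbit (f \<circ> transpose a b) a"
proof
  let ?g = "f \<circ> transpose a b"
  assume "b \<in> orbit ?g a"
  have g: "permutation ?g" by (simp add: f permutation_compose permutation_swap_id)
  define n where "n = (LEAST n. (f ^^ n) a = b)"
  have n: "(f ^^ n) a = b" unfolding n_def
    by (rule LeastI_ex) (use b in \<open>auto simp: orbit_altdef\<close>)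
  have least: "(f ^^ m) a \<noteq> b" if "m < n" for m
    using not_less_Least that unfolding n_def by blast
  have "n \<noteq> 0" using n \<open>a \<noteq> b\<close> by (cases n) auto
  have return: "(f ^^ m) a \<noteq> a" if "0 < m" "m \<le> n" for m
  proof
    assume m: "(f ^^ m) a = a"
    have "(f ^^ (n - m)) a = (f ^^ (n - m)) ((f ^^ m) a)" using m by simp
    also have "\<dots> = (f ^^ n) a"
      using that by (metis comp_apply funpow_add le_add_diff_inverse2)
    finally show False using least[of "n - m"] n that by simp
  qed
  define X where "X = {(f ^^ m) a | m. 0 < m \<and> m \<le> n}"
  have "orbit ?g b \<subseteq> X"
  proof (rule orbit_subsetI)
    show "b \<in> X" using n \<open>n \<noteq> 0\<close> unfolding X_def by blast
  next
    fix y assume "y \<in> X"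
    then obtain m where m: "y = (f ^^ m) a" "0 < m" "m \<le> n" unfolding X_def by blast
    show "?g y \<in> X"
    proof (cases "m = n")
      case True
      then have "?g y = (f ^^ 1) a" using m n by simp
      then show ?thesis unfolding X_def using \<open>n \<noteq> 0\<close> by (metis (mono_tags, lifting) One_nat_def Suc_leI lessI mem_Collect_eq neq0_conv)
    next
      case False
      then have "y \<noteq> b" "y \<noteq> a" using least[of m] return[of m] m by auto
      then have "?g y = (f ^^ Suc m) a" using m by (simp add: transpose_def)
      then show ?thesis unfolding X_def using False m by (metis (mono_tags, lifting) Suc_leI le_neq_implies_less mem_Collect_eq zero_less_Suc)
    qed
  qed
  moreover have "a \<notin> X"
  proof
    assume "a \<in> X"
    then obtain m where "a = (f ^^ m) a" "0 < m" "m \<le> n" unfolding X_def by blast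
    then show False using return[of m] by simp
  qed
  moreover have "a \<in> orbit ?g b" using \<open>b \<in> orbit ?g a\<close> g by (metis orbit_swap permutation_self_in_orbit)
  ultimately show False by blast
qed

lemma card_orbits_merge:
  assumes f: "f permutes D" and D: "finite D" "a \<in> D" "b \<in> D" and b: "b \<notin> orbit f a"
  shows "Suc (card (orbit (f \<circ> transpose a b) ` D)) = card (orbit f ` D)"
proof -
  let ?g = "f \<circ> transpose a b"
  have p: "permutation f" using f D by (simp add: permutes_permutation)
  have sub: "orbit f a \<subseteq> D" "orbit f b \<subseteq> D" using permutes_orbit_subset[OF f] D by auto
  define R where "R = orbit f ` (D - (orbit f a \<union> orbit f b))"
  have self: "x \<in> orbit f x" for x using p by (rule permutation_self_in_orbit)
  have 1: "orbit f ` D = insert (orbit f a) (insert (orbit f b) R)"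
    unfolding R_def using D orbit_eqI_mem[OF p] by blast
  have eq: "orbit ?g x = orbit f x" if "x \<notin> orbit f a \<union> orbit f b" for x
    using that by (intro orbit_transpose_other[OF p]) (metis Un_iff orbit_swap self)+
  have R': "orbit ?g ` (D - (orbit f a \<union> orbit f b)) = R"
    unfolding R_def using eq by (intro image_cong) auto
  have m: "orbit ?g x = orbit f a \<union> orbit f b" if "x \<in> orbit f a \<union> orbit f b" for x
    using orbit_transpose_merge[OF p b that] .
  have "D = (D - (orbit f a \<union> orbit f b)) \<union> (orbit f a \<union> orbit f b)" using sub by blast
  then have "orbit ?g ` D = R \<union> orbit ?g ` (orbit f a \<union> orbit f b)"
    using R' by (metis image_Un)
  also have "orbit ?g ` (orbit f a \<union> orbit f b) = {orbit f a \<union> orbit f b}"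
    using m self by fastforce
  finally have 2: "orbit ?g ` D = insert (orbit f a \<union> orbit f b) R" unfolding Un_insert_right Un_empty_right .
  have nR: "orbit f a \<notin> R" "orbit f b \<notin> R" "orbit f a \<union> orbit f b \<notin> R"
    unfolding R_def using self by blast+
  have "orbit f a \<noteq> orbit f b" using b self by auto
  then show ?thesis unfolding 1 2 using nR D R_def by (simp add: card_insert_if)
qed

lemma card_orbits_split:
  assumes f: "f permutes D" and D: "finite D" "a \<in> D" "b \<in> D" and b: "b \<in> orbit f a" "a \<noteq> b"
  shows "card (orbit (f \<circ> transpose a b) ` D) = Suc (card (orbit f ` D))"
proof -
  let ?g = "f \<circ> transpose a b"
  have "permutation f" using f D by (simp add: permutes_permutation)
  then have "b \<notin> orbit ?g a" using b by (intro orbit_transpose_split)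
  moreover have "?g permutes D" using f D by (simp add: permutes_compose permutes_swap_id)
  ultimately have "Suc (card (orbit (?g \<circ> transpose a b) ` D)) = card (orbit ?g ` D)"
    using D by (intro card_orbits_merge)
  moreover have "?g \<circ> transpose a b = f" by (simp add: comp_assoc)
  ultimately show ?thesis by simp
qed

lemma card_orbits_transpose_le:
  assumes f: "f permutes D" and D: "finite D" "a \<in> D" "b \<in> D"
  shows "card (orbit (f \<circ> transpose a b) ` D) \<le> Suc (card (orbit f ` D))"
proof (cases "a = b")
  case False
  then show ?thesis
    using card_orbits_merge[OF assms] card_orbits_split[OF assms]
    by (cases "b \<in> orbit f a") auto
qed simp

definition transitive_on :: "'a set \<Rightarrow> ('a \<Rightarrow> 'a) \<Rightarrow> ('a \<Rightarrow> 'a) \<Rightarrow> bool" where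
  "transitive_on D f g \<longleftrightarrow>
     (\<forall>X. X \<noteq> {} \<and> X \<subseteq> D \<and> f ` X \<subseteq> X \<and> g ` X \<subseteq> X \<longrightarrow> X = D)"

lemma transitive_onD:
  assumes "transitive_on D f g" "X \<noteq> {}" "X \<subseteq> D"
    "\<And>x. x \<in> X \<Longrightarrow> f x \<in> X" "\<And>x. x \<in> X \<Longrightarrow> g x \<in> X"
  shows "X = D"
  using assms unfolding transitive_on_def by (metis image_subsetI)

lemma transitive_onI:
  assumes "\<And>X. X \<noteq> {} \<Longrightarrow> X \<subseteq> D \<Longrightarrow> (\<And>x. x \<in> X \<Longrightarrow> f x \<in> X) \<Longrightarrow> (\<And>x. x \<in> X \<Longrightarrow> g x \<in> X) \<Longrightarrow> X = D"
  shows "transitive_on D f g"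
  using assms unfolding transitive_on_def image_subset_iff by metis

lemma Euler_inequality_perms:
  assumes "finite D" "D \<noteq> {}" "f permutes D" "g permutes D" "\<And>x. g (g x) = x"
    and "transitive_on D f g"
  shows "2 * card (orbit (f \<circ> g) ` D) + 2 * card (orbit f ` D) \<le> card {x. g x \<noteq> x} + 4"
  using assms
proof (induction "card {x. g x \<noteq> x}" arbitrary: f g rule: less_induct)
  case less
  note D = less.prems(1,2) and f = less.prems(3) and g = less.prems(4) and inv = less.prems(5)
    and trans = less.prems(6)
  have p: "permutation f" using f D by (simp add: permutes_permutation)
  have self: "x \<in> orbit f x" for x using p by (rule permutation_self_in_orbit)
  have fin: "finite {x. g x \<noteq> x}"
    by (rule finite_subset[OF _ D(1)]) (use g in \<open>auto dest: permutes_not_in\<close>)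
  show ?case
  proof (cases "\<exists>a\<in>D. g a \<noteq> a \<and> (g a \<notin> orbit f a \<or> (\<forall>x\<in>D. g x \<in> orbit f x))")
    case False
    then have id: "g x = x" if "g x \<in> orbit f x" for x
      using False self g by (metis permutes_not_in)
    have gid: "g x = x" for x using id False g by (metis permutes_not_in)
    obtain d where d: "d \<in> D" using D by auto
    have X: "orbit f d = D" using trans permutes_orbit_subset[OF f d] self gid
      unfolding transitive_on_def by (metis (no_types, lifting) empty_iff image_subsetI orbit.step)
    have "orbit f x = D" if "x \<in> D" for x using X that orbit_eqI_mem[OF p] by metis
    then have "orbit f ` D = {D}" using d by (auto intro!: image_eqI)
    moreover have "f \<circ> g = f" using gid by auto
    ultimately show ?thesis by simp
  next
    case True
    then obtain a where a: "a \<in> D" "g a \<noteq> a" 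
      and cases: "g a \<notin> orbit f a \<or> (\<forall>x\<in>D. g x \<in> orbit f x)" by auto
    define b where "b = g a"
    have b: "b \<in> D" "a \<noteq> b" "g b = a" "g a = b"
      using a g inv b_def by (auto simp: permutes_in_image)
    define g' where "g' = transpose a b \<circ> g"
    have g': "g' x = (if x = a \<or> x = b then x else g x)" for x
    proof -
      have "g x = a \<longleftrightarrow> x = b" "g x = b \<longleftrightarrow> x = a" using b b_def inv by metis+
      then show ?thesis unfolding g'_def using b by (auto simp: transpose_def)
    qed
    have g'p: "g' permutes D" unfolding g'_def
      using a b g by (simp add: permutes_compose permutes_swap_id)
    have inv': "g' (g' x) = x" for x
    proof -
      have "g x = a \<longleftrightarrow> x = b" "g x = b \<longleftrightarrow> x = a" using b b_def inv by metis+
      then show ?thesis unfolding g' by (simp add: inv)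
    qed
    have nf: "{x. g x \<noteq> x} = insert a (insert b {x. g' x \<noteq> x})"
      unfolding g' using b by auto
    have card: "card {x. g x \<noteq> x} = card {x. g' x \<noteq> x} + 2"
    proof -
      have "finite {x. g' x \<noteq> x}" using fin nf by simp
      moreover have "a \<notin> {x. g' x \<noteq> x}" "b \<notin> {x. g' x \<noteq> x}" by (auto simp: g')
      ultimately show ?thesis unfolding nf using b by simp
    qed
    show ?thesis
    proof (cases "b \<in> orbit f a")
      case False
      define f' where "f' = f \<circ> transpose a b"
      have f': "f' permutes D" unfolding f'_def
        using f a b by (simp add: permutes_compose permutes_swap_id)
      have "transitive_on D f' g'" unfolding transitive_on_def
      proof (intro allI impI)
        fix X assume X: "X \<noteq> {} \<and> X \<subseteq> D \<and> f' ` X \<subseteq> X \<and> g' ` X \<subseteq> X"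
        have ab: "a \<in> X \<longleftrightarrow> b \<in> X"
        proof -
          have ora: "orbit f' x = orbit f a \<union> orbit f b" if "x = a \<or> x = b" for x
            unfolding f'_def by (rule orbit_transpose_merge[OF p False]) (use that self in auto)
          have "orbit f' x \<subseteq> X" if "x \<in> X" for x
            using X that by (intro orbit_subsetI) auto
          then show ?thesis using ora self by blast
        qed
        have "f ` X \<subseteq> X"
        proof
          fix y assume "y \<in> f ` X"
          then obtain x where x: "x \<in> X" "y = f x" by blast
          have "transpose a b x \<in> X"
            by (metis ab transpose_apply_first transpose_apply_second transpose_apply_other x(1))
          moreover have "y = f' (transpose a b x)" using x by (simp add: f'_def)
          ultimately show "y \<in> X" using X by blast
        qed
        moreover have "g ` X \<subseteq> X"
        proof
          fix y assume "y \<in> g ` X"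
          then obtain x where x: "x \<in> X" "y = g x" by blast
          show "y \<in> X"
          proof (cases "x = a \<or> x = b")
            case True then show ?thesis using x ab b by auto
          next
            case False
            then have "y = g' x" using x g' by simp
            then show ?thesis using x X by blast
          qed
        qed
        ultimately show "X = D" using trans X unfolding transitive_on_def by metis
      qed
      from less.hyps[OF _ D f' g'p inv' this] card
      have "2 * card (orbit (f' \<circ> g') ` D) + 2 * card (orbit f' ` D) \<le> card {x. g' x \<noteq> x} + 4"
        by simp
      moreover have "f' \<circ> g' = f \<circ> g" unfolding f'_def g'_def by (simp add: fun_eq_iff)
      moreover have "Suc (card (orbit f' ` D)) = card (orbit f ` D)" unfolding f'_def
        by (rule card_orbits_merge[OF f D(1) a(1) b(1) False])
      ultimately show ?thesis using card by simp
    next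
      case True
      then have all: "\<forall>x\<in>D. g x \<in> orbit f x" using cases b_def by auto
      have tr: "transitive_on D f g'" unfolding transitive_on_def
      proof (intro allI impI)
        fix X assume X: "X \<noteq> {} \<and> X \<subseteq> D \<and> f ` X \<subseteq> X \<and> g' ` X \<subseteq> X"
        have "orbit f x \<subseteq> X" if "x \<in> X" for x
          using X that by (intro orbit_subsetI) auto
        then have "g ` X \<subseteq> X" using all X by blast
        then show "X = D" using trans X unfolding transitive_on_def by metis
      qed
      from less.hyps[OF _ D f g'p inv' this] card
      have 1: "2 * card (orbit (f \<circ> g') ` D) + 2 * card (orbit f ` D) \<le> card {x. g' x \<noteq> x} + 4"
        by simp
      have "f \<circ> g = f \<circ> g' \<circ> transpose a b"
      proof
        fix x show "(f \<circ> g) x = (f \<circ> g' \<circ> transpose a b) x"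
          using b inv by (auto simp: g' transpose_def)
      qed
      moreover have "f \<circ> g' permutes D" using f g'p by (simp add: permutes_compose)
      ultimately have "card (orbit (f \<circ> g) ` D) \<le> Suc (card (orbit (f \<circ> g') ` D))"
        using card_orbits_transpose_le D a b by metis
      with 1 card show ?thesis by simp
    qed
  qed
qed

lemma orbit_return2:
  assumes f: "permutation f" and "f (f x) = x"
  shows "orbit f x = {x, f x}"
proof
  show "orbit f x \<subseteq> {x, f x}" by (rule orbit_subsetI) (use assms in auto)
  show "{x, f x} \<subseteq> orbit f x" using permutation_self_in_orbit[OF f] orbit.base by auto
qed

lemma orbit_return4:
  assumes "f (f (f (f x))) = x"
  shows "orbit f x = {x, f x, f (f x), f (f (f x))}"
proof -
  have "(f ^^ 4) x = x" using assms by (simp add: eval_nat_numeral)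
  then have "orbit f x = {(f ^^ m) x | m. m < 4}" by (rule orbit_altdef_bounded) simp
  also have "\<dots> = (\<lambda>m. (f ^^ m) x) ` {m. m < 4}" by blast
  also have "{m::nat. m < 4} = {0, 1, 2, 3}" by auto
  finally show ?thesis by (simp add: eval_nat_numeral)
qed

lemma orbit4_iff:
  assumes "permutation f"
  shows "card (orbit f x) = 4 \<longleftrightarrow> f (f (f (f x))) = x \<and> f (f x) \<noteq> x"
proof
  let ?n = "funpow_dist1 f x x"
  have self: "x \<in> orbit f x" using assms by (rule permutation_self_in_orbit)
  assume "card (orbit f x) = 4"
  moreover have "card (orbit f x) = ?n"
    unfolding orbit_conv_funpow_dist1[OF self] using inj_on_funpow_dist1[OF self]
    by (simp add: card_image)
  ultimately have n: "?n = 4" by simp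
  from funpow_dist1_prop[OF self] funpow_dist1_least[of 2 f x x]
  show "f (f (f (f x))) = x \<and> f (f x) \<noteq> x" unfolding n by (simp add: eval_nat_numeral)
next
  assume f: "f (f (f (f x))) = x \<and> f (f x) \<noteq> x"
  have inj: "f a = f b \<longleftrightarrow> a = b" for a b
    using assms by (metis bij_pointE permutation_bijective)
  have "orbit f x = {x, f x, f (f x), f (f (f x))}" using f by (intro orbit_return4) simp
  moreover have "distinct [x, f x, f (f x), f (f (f x))]" using f by (auto simp: inj)
  ultimately show "card (orbit f x) = 4" by auto
qed

lemma sum_card_orbits:
  assumes f: "f permutes D" and D: "finite D"
  shows "(\<Sum>S\<in>orbit f ` D. card S) = card D"
proof -
  have p: "permutation f" using assms by (rule permutes_permutation)
  have "\<Union> (orbit f ` D) = D"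
    using permutes_orbit_subset[OF f] permutation_self_in_orbit[OF p] by blast
  moreover have "card (\<Union> (orbit f ` D)) = (\<Sum>S\<in>orbit f ` D. card S)"
  proof (rule card_Union_disjoint)
    show "pairwise disjnt (orbit f ` D)"
      unfolding pairwise_def disjnt_def using orbit_eqI_mem[OF p] by blast
  qed (use finite_orbit[OF permutation_self_in_orbit[OF p]] in auto)
  ultimately show ?thesis by simp
qed

lemma card_orbits_uniform:
  assumes "f permutes D" "finite D" "\<And>x. x \<in> D \<Longrightarrow> card (orbit f x) = k"
  shows "k * card (orbit f ` D) = card D"
proof -
  have "(\<Sum>S\<in>orbit f ` D. card S) = (\<Sum>S\<in>orbit f ` D. k)" by (rule sum.cong) (use assms in auto)
  then show ?thesis using sum_card_orbits[OF assms(1,2)] by (simp add: mult.commute)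
qed

subsection \<open>Maps\<close>

definition premap :: "'d cmap \<Rightarrow> bool" where
  "premap M \<longleftrightarrow>
     finite (darts M) \<and> opp M permutes darts M \<and> rot M permutes darts M \<and>
     (\<forall>d\<in>darts M. opp M d \<noteq> d \<and> opp M (opp M d) = d)"

abbreviation transitive_map :: "'d cmap \<Rightarrow> bool" where
  "transitive_map M \<equiv> transitive_on (darts M) (rot M) (opp M)"

context
  fixes M :: "'d cmap"
  assumes M: "premap M"
begin

lemma premap_finite: "finite (darts M)"
  and premap_opp: "opp M permutes darts M"
  and premap_rot: "rot M permutes darts M"
  using M by (simp_all add: premap_def)

lemma opp_neq: "d \<in> darts M \<Longrightarrow> opp M d \<noteq> d"
  using M by (simp add: premap_def)

lemma opp_opp: "opp M (opp M d) = d"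
  using M by (metis permutes_not_in premap_def)

lemma fnext_comp: "fnext M = rot M \<circ> opp M"
  by (auto simp: fnext_def)

lemma fnext_opp: "fnext M (opp M d) = rot M d"
  by (simp add: fnext_def opp_opp)

lemma fnext_permutes: "fnext M permutes darts M"
  unfolding fnext_comp using premap_rot premap_opp by (simp add: permutes_compose)

lemma opp_in: "opp M d \<in> darts M \<longleftrightarrow> d \<in> darts M"
  and rot_in: "rot M d \<in> darts M \<longleftrightarrow> d \<in> darts M"
  and fnext_in: "fnext M d \<in> darts M \<longleftrightarrow> d \<in> darts M"
  using premap_rot premap_opp fnext_permutes by (simp_all add: permutes_in_image)

lemma opp_eq: "opp M a = opp M b \<longleftrightarrow> a = b"
  and rot_eq: "rot M a = rot M b \<longleftrightarrow> a = b"
  and fnext_eq: "fnext M a = fnext M b \<longleftrightarrow> a = b"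
  using premap_rot premap_opp fnext_permutes by (meson injD permutes_inj)+

lemma opp_flip: "opp M a = b \<longleftrightarrow> a = opp M b"
  using opp_opp by auto

lemma rot_perm: "permutation (rot M)"
  and opp_perm: "permutation (opp M)"
  and fnext_perm: "permutation (fnext M)"
  using premap_rot premap_opp fnext_permutes premap_finite by (simp_all add: permutes_permutation)

lemma vert_self: "d \<in> vert M d"
  unfolding vert_def by (rule permutation_self_in_orbit[OF rot_perm])

lemma vert_eq_iff: "vert M x = vert M y \<longleftrightarrow> x \<in> vert M y"
  unfolding vert_def by (rule orbit_eq_iff[OF rot_perm])

lemma vert_rot: "vert M (rot M x) = vert M x"
  unfolding vert_def by (rule permutation_orbit_step[OF rot_perm])

lemma vert_fnext: "vert M (fnext M x) = vert M (opp M x)"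
  by (simp add: fnext_def vert_rot)

lemma vert_subset: "x \<in> darts M \<Longrightarrow> vert M x \<subseteq> darts M"
  unfolding vert_def by (rule permutes_orbit_subset[OF premap_rot])

lemma connected_map_iff_transitive: "connected_map M \<longleftrightarrow> transitive_map M"
proof
  let ?R = "\<lambda>p q. q = opp M p \<or> q = rot M p"
  assume c: "connected_map M"
  show "transitive_map M"
  proof (rule transitive_onI)
    fix X assume X: "X \<noteq> {}" "X \<subseteq> darts M" "\<And>x. x \<in> X \<Longrightarrow> rot M x \<in> X" "\<And>x. x \<in> X \<Longrightarrow> opp M x \<in> X"
    then obtain x where x: "x \<in> X" by blast
    have "y \<in> X" if "?R\<^sup>*\<^sup>* x y" for y
      using that by induction (use x X in auto)
    then show "X = darts M" using c x X(2) unfolding connected_map_def by blast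
  qed
next
  let ?R = "\<lambda>p q. q = opp M p \<or> q = rot M p"
  assume t: "transitive_map M"
  show "connected_map M" unfolding connected_map_def
  proof (intro ballI)
    fix x y assume xy: "x \<in> darts M" "y \<in> darts M"
    have "{z. ?R\<^sup>*\<^sup>* x z} = darts M"
    proof (rule transitive_onD[OF t])
      show "{z. ?R\<^sup>*\<^sup>* x z} \<subseteq> darts M"
      proof
        fix z assume "z \<in> {z. ?R\<^sup>*\<^sup>* x z}"
        then have "?R\<^sup>*\<^sup>* x z" by simp
        then show "z \<in> darts M" by induction (auto simp: xy opp_in rot_in)
      qed
    qed (auto intro: rtranclp.rtrancl_into_rtrancl)
    then show "?R\<^sup>*\<^sup>* x y" using xy by blast
  qed
qed

lemma card_edges: "2 * card (edges M) = card (darts M)"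
  unfolding edges_def edge_def[abs_def]
proof (rule card_orbits_uniform[OF premap_opp premap_finite])
  fix x assume x: "x \<in> darts M"
  have "orbit (opp M) x = {x, opp M x}" by (rule orbit_return2[OF opp_perm opp_opp])
  then show "card (orbit (opp M) x) = 2" using opp_neq[OF x] by auto
qed

lemma Euler_inequality:
  assumes "transitive_map M" "darts M \<noteq> {}"
  shows "2 * card (orbit (rot M) ` darts M) + 2 * card (orbit (fnext M) ` darts M) \<le> card (darts M) + 4"
proof -
  have "{x. opp M x \<noteq> x} = darts M" using opp_neq premap_opp by (auto dest: permutes_not_in)
  then show ?thesis
    using Euler_inequality_perms[OF premap_finite assms(2) premap_rot premap_opp opp_opp assms(1)]
    by (simp add: fnext_comp)
qed

end

lemma is_map_iff: "is_map M \<longleftrightarrow> premap M \<and> transitive_map M"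
  using connected_map_iff_transitive unfolding is_map_def premap_def by blast

lemma plane_quadrangulation_iff:
  "plane_quadrangulation M \<longleftrightarrow> premap M \<and> transitive_map M \<and>
     (\<forall>d\<in>darts M. card (orbit (fnext M) d) = 4) \<and>
     4 * card (orbit (rot M) ` darts M) = card (darts M) + 8"
proof -
  { assume M: "premap M" and F: "\<forall>d\<in>darts M. card (orbit (fnext M) d) = 4"
    have "4 * card (orbit (fnext M) ` darts M) = card (darts M)"
      by (rule card_orbits_uniform[OF fnext_permutes[OF M] premap_finite[OF M]]) (use F in auto)
    with card_edges[OF M] have
      "plane M \<longleftrightarrow> 4 * card (orbit (rot M) ` darts M) = card (darts M) + 8"
      unfolding plane_def vertices_def faces_def face_def[abs_def] vert_def[abs_def] by linarith }
  then show ?thesis unfolding plane_quadrangulation_def is_map_iff faces_def face_def[abs_def]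
    by auto
qed

definition colouring :: "'d cmap \<Rightarrow> ('d \<Rightarrow> bool) \<Rightarrow> bool" where
  "colouring M c \<longleftrightarrow> (\<forall>d\<in>darts M. c (opp M d) = (\<not> c d) \<and> c (rot M d) = c d)"

text \<open>The double cover, in which every step along an edge changes the sheet, would violate
  Euler's inequality if it were connected.\<close>

lemma bipartite:
  assumes Q: "plane_quadrangulation M"
  obtains c where "colouring M c"
proof -
  have M: "premap M" and t: "transitive_map M"
    and F: "\<And>d. d \<in> darts M \<Longrightarrow> card (orbit (fnext M) d) = 4"
    and V: "4 * card (orbit (rot M) ` darts M) = card (darts M) + 8"
    using Q unfolding plane_quadrangulation_iff by auto
  note fin = premap_finite[OF M]
  let ?D = "darts M \<times> (UNIV :: bool set)"
  define s :: "'a \<times> bool \<Rightarrow> 'a \<times> bool" where "s = map_prod (rot M) id"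
  define a :: "'a \<times> bool \<Rightarrow> 'a \<times> bool" where
    "a = (\<lambda>(d, i). if d \<in> darts M then (opp M d, \<not> i) else (d, i))"
  have s: "s permutes ?D"
    using premap_rot[OF M] unfolding s_def permutes_def
    by (auto simp: map_prod_def split: prod.splits) metis+
  have a_invol: "a (a x) = x" for x
    unfolding a_def by (auto simp: opp_opp[OF M] opp_in[OF M] split: prod.splits)
  have a: "a permutes ?D"
  proof -
    have "a x = x" if "x \<notin> ?D" for x using that by (cases x) (auto simp: a_def)
    moreover have "\<exists>!x. a x = y" for y
      by (rule ex1I[of _ "a y"]) (use a_invol in auto)
    ultimately show ?thesis unfolding permutes_def by simp
  qed
  have Dcard: "card ?D = 2 * card (darts M)" by (simp add: card_cartesian_product)
  have afix: "{x. a x \<noteq> x} = ?D" unfolding a_def using opp_neq[OF M] by (auto split: if_splits)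
  have sa: "(s \<circ> a) (d, i) = (fnext M d, \<not> i)" if "d \<in> darts M" for d i
    using that unfolding s_def a_def by (simp add: fnext_def)
  have p: "permutation (s \<circ> a)" using s a fin
    by (intro permutes_permutation[of _ ?D]) (auto simp: permutes_compose)
  have "4 * card (orbit (s \<circ> a) ` ?D) = card ?D"
  proof (rule card_orbits_uniform)
    show "s \<circ> a permutes ?D" using s a by (simp add: permutes_compose)
    fix x assume "x \<in> ?D"
    then obtain d i where x: "x = (d, i)" "d \<in> darts M" by auto
    with F[of d] show "card (orbit (s \<circ> a) x) = 4"
      unfolding orbit4_iff[OF p] orbit4_iff[OF fnext_perm[OF M]]
      by (simp add: sa fnext_in[OF M] del: comp_apply)
  qed (use fin in simp)
  moreover have "card (orbit s ` ?D) = 2 * card (orbit (rot M) ` darts M)"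
  proof -
    have *: "orbit s (d, i) = orbit (rot M) d \<times> {i}" for d i
    proof -
      have "orbit s (d, i) = {(s ^^ n) (d, i) |n. 0 < n}" by (simp add: orbit_altdef)
      moreover have "(s ^^ n) (d, i) = ((rot M ^^ n) d, i)" for n
        by (induction n) (auto simp: s_def)
      ultimately show ?thesis by (auto simp: orbit_altdef)
    qed
    have "orbit s ` ?D = (\<lambda>(S, i). S \<times> {i}) ` (orbit (rot M) ` darts M \<times> UNIV)"
      (is "?A = ?B")
    proof (intro set_eqI iffI)
      fix y assume "y \<in> ?A"
      then obtain d i where "d \<in> darts M" "y = orbit (rot M) d \<times> {i}" using * by auto
      then show "y \<in> ?B" by (intro image_eqI[of _ _ "(orbit (rot M) d, i)"]) auto
    next
      fix y assume "y \<in> ?B"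
      then obtain d i where "d \<in> darts M" "y = orbit s (d, i)" using * by auto
      then show "y \<in> ?A" by (intro image_eqI[of _ _ "(d, i)"]) auto
    qed
    moreover have "inj_on (\<lambda>(S, i). S \<times> {i}) (orbit (rot M) ` darts M \<times> (UNIV :: bool set))"
      using orbit_nonempty by (fastforce intro!: inj_onI simp: times_eq_iff)
    ultimately show ?thesis by (simp add: card_image card_cartesian_product)
  qed
  moreover have "darts M \<noteq> {}" using V by auto
  ultimately have "\<not> transitive_on ?D s a"
    using Euler_inequality_perms[of ?D s a] s a a_invol fin V Dcard unfolding afix by fastforce
  then obtain X where X': "X \<noteq> {} \<and> X \<subseteq> ?D \<and> s ` X \<subseteq> X \<and> a ` X \<subseteq> X" "X \<noteq> ?D"
    unfolding transitive_on_def by metis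
  then have X: "X \<noteq> {}" "X \<subseteq> ?D" "X \<noteq> ?D" by simp_all
  have Xs: "s x \<in> X" if "x \<in> X" for x using X' that by blast
  have Xa: "a x \<in> X" if "x \<in> X" for x using X' that by blast
  have Xs': "(rot M d, i) \<in> X" if "(d, i) \<in> X" for d i using Xs[OF that] by (simp add: s_def)
  have Xa': "(opp M d, \<not> i) \<in> X" if "(d, i) \<in> X" for d i
    using Xa[OF that] X that by (auto simp: a_def)
  have "{d. \<exists>i. (d, i) \<in> X} = darts M"
    by (rule transitive_onD[OF t]) (use X Xs' Xa' in blast)+
  moreover have "{d. (d, True) \<in> X \<and> (d, False) \<in> X} = {}"
  proof (rule ccontr)
    assume "{d. (d, True) \<in> X \<and> (d, False) \<in> X} \<noteq> {}"
    then have "{d. (d, True) \<in> X \<and> (d, False) \<in> X} = darts M"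
      by (rule transitive_onD[OF t]) (use X Xs' Xa' in fastforce)+
    then have "(d, i) \<in> X" if "d \<in> darts M" for d i using that by (cases i) auto
    then show False using X by auto
  qed
  ultimately have xor: "(d, False) \<in> X \<longleftrightarrow> (d, True) \<notin> X" if "d \<in> darts M" for d
  proof -
    assume all: "{d. \<exists>i. (d, i) \<in> X} = darts M" and no: "{d. (d, True) \<in> X \<and> (d, False) \<in> X} = {}"
    from all that obtain i where "(d, i) \<in> X" by blast
    then show ?thesis using no by (cases i) auto
  qed
  have "colouring M (\<lambda>d. (d, True) \<in> X)" unfolding colouring_def
  proof (intro ballI conjI)
    fix d assume d: "d \<in> darts M"
    show "((opp M d, True) \<in> X) = ((d, True) \<notin> X)"
      using Xa'[of d True] Xa'[of d False] xor[of d] xor[of "opp M d"] d opp_in[OF M] by auto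
    show "((rot M d, True) \<in> X) = ((d, True) \<in> X)"
      using Xs'[of d True] Xs'[of d False] xor[of d] xor[of "rot M d"] d rot_in[OF M] by auto
  qed
  then show ?thesis by (rule that)
qed

subsection \<open>Cutting along a pair of parallel edges\<close>

definition submap :: "'d set \<Rightarrow> 'd cmap \<Rightarrow> 'd cmap" where
  "submap A M = \<lparr>darts = A, opp = (\<lambda>x. if x \<in> A then opp M x else x),
     rot = (\<lambda>x. if x \<in> A then rot M x else x)\<rparr>"

definition closed_in :: "'d cmap \<Rightarrow> 'd set \<Rightarrow> bool" where
  "closed_in M X \<longleftrightarrow> X \<subseteq> darts M \<and> (\<forall>x\<in>X. rot M x \<in> X \<and> opp M x \<in> X)"

lemma closed_in_subset: "closed_in M X \<Longrightarrow> X \<subseteq> darts M"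
  by (simp add: closed_in_def)

lemma transitive_map_iff_closed: "transitive_map M \<longleftrightarrow> (\<forall>X. closed_in M X \<and> X \<noteq> {} \<longrightarrow> X = darts M)"
  unfolding transitive_on_def closed_in_def image_subset_iff by metis

lemma permutes_closed_bij:
  assumes "f permutes D" "finite D" "X \<subseteq> D" "\<And>x. x \<in> X \<Longrightarrow> f x \<in> X"
  shows "f x \<in> X \<longleftrightarrow> x \<in> X"
proof -
  have inj: "inj f" using assms(1) by (rule permutes_inj)
  have "finite X" using assms finite_subset by blast
  then have "f ` X = X" using assms inj
    by (intro endo_inj_surj) (auto intro: inj_on_subset)
  then show ?thesis using inj by (metis inj_image_mem_iff)
qed

lemma closed_in_iff:
  assumes M: "premap M" and X: "closed_in M X"
  shows "rot M x \<in> X \<longleftrightarrow> x \<in> X" "opp M x \<in> X \<longleftrightarrow> x \<in> X" "fnext M x \<in> X \<longleftrightarrow> x \<in> X"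
proof -
  show "rot M x \<in> X \<longleftrightarrow> x \<in> X" for x
    using X by (intro permutes_closed_bij[OF premap_rot[OF M] premap_finite[OF M]]) (auto simp: closed_in_def)
  moreover show "opp M x \<in> X \<longleftrightarrow> x \<in> X" for x
    using X by (intro permutes_closed_bij[OF premap_opp[OF M] premap_finite[OF M]]) (auto simp: closed_in_def)
  ultimately show "fnext M x \<in> X \<longleftrightarrow> x \<in> X" by (simp add: fnext_def)
qed

lemma closed_in_Diff:
  assumes M: "premap M" and "closed_in M X" "closed_in M Y"
  shows "closed_in M (X - Y)"
proof -
  have "X - Y \<subseteq> darts M" using closed_in_subset[OF assms(2)] by auto
  then show ?thesis
    by (simp add: closed_in_def closed_in_iff[OF M assms(2)] closed_in_iff[OF M assms(3)])
qed

lemma closed_in_darts: "premap M \<Longrightarrow> closed_in M (darts M)"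
  unfolding closed_in_def by (simp add: rot_in opp_in)

lemma closed_in_orbit:
  assumes "premap M" "closed_in M X" "x \<in> X"
  shows "orbit (rot M) x \<subseteq> X" "orbit (fnext M) x \<subseteq> X"
  by (rule orbit_subsetI[OF assms(3)], simp add: closed_in_iff[OF assms(1,2)])+

context
  fixes M :: "'d cmap" and A
  assumes M: "premap M" and A: "closed_in M A"
begin

lemma submap_simps:
  shows "darts (submap A M) = A"
    and "x \<in> A \<Longrightarrow> rot (submap A M) x = rot M x"
    and "x \<in> A \<Longrightarrow> opp (submap A M) x = opp M x"
    and "x \<in> A \<Longrightarrow> fnext (submap A M) x = fnext M x"
  using closed_in_iff[OF M A] by (simp_all add: submap_def fnext_def)

lemma submap_premap: "premap (submap A M)"
proof -
  have *: "(\<lambda>x. if x \<in> A then f x else x) permutes A"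
    if f: "f permutes darts M" and fA: "\<And>x. f x \<in> A \<longleftrightarrow> x \<in> A" for f
    unfolding permutes_def
  proof (intro conjI allI impI)
    fix y
    obtain x where x: "f x = y" using f by (metis permutes_def)
    have inj: "f a = f b \<longleftrightarrow> a = b" for a b using f by (meson injD permutes_inj)
    show "\<exists>!x. (if x \<in> A then f x else x) = y"
    proof (cases "y \<in> A")
      case True
      then show ?thesis using x fA inj by (intro ex1I[of _ x]) (auto split: if_splits)
    next
      case False
      then show ?thesis using fA by (intro ex1I[of _ y]) (auto split: if_splits)
    qed
  qed auto
  have "A \<subseteq> darts M" using A by (simp add: closed_in_def)
  then show ?thesis unfolding premap_def submap_simps
    using * premap_rot[OF M] premap_opp[OF M] closed_in_iff[OF M A] premap_finite[OF M]
      opp_neq[OF M] opp_opp[OF M]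
    by (auto simp: submap_def finite_subset)
qed

lemma submap_orbits:
  assumes "x \<in> A"
  shows "orbit (rot (submap A M)) x = orbit (rot M) x" "orbit (fnext (submap A M)) x = orbit (fnext M) x"
proof -
  note * = closed_in_iff[OF M A]
  show "orbit (rot (submap A M)) x = orbit (rot M) x"
    by (rule orbit_cong0[OF assms]) (auto simp: submap_simps *)
  show "orbit (fnext (submap A M)) x = orbit (fnext M) x"
    by (rule orbit_cong0[OF assms]) (auto simp: submap_simps *)
qed

lemma submap_transitive:
  assumes "\<And>Y. closed_in M Y \<Longrightarrow> Y \<noteq> {} \<Longrightarrow> Y \<subseteq> A \<Longrightarrow> Y = A"
  shows "transitive_map (submap A M)"
  unfolding transitive_map_iff_closed
proof (intro allI impI)
  fix X assume X: "closed_in (submap A M) X \<and> X \<noteq> {}"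
  then have XA: "X \<subseteq> A" unfolding closed_in_def submap_simps by simp
  then have "closed_in M X" using X A
    unfolding closed_in_def submap_simps(1) by (auto simp: submap_simps subset_iff)
  then show "X = darts (submap A M)" using assms X XA by (simp add: submap_simps)
qed

end

text \<open>Slitting the surface along two parallel edges and closing each of the two slits leaves the
  facial walks alone and splits both end vertices. So the number of vertices grows by 2, and on the
  sphere the two sides fall apart.\<close>

definition cut :: "'d cmap \<Rightarrow> 'd \<Rightarrow> 'd \<Rightarrow> 'd cmap" where
  "cut M p1 p2 = (let t = transpose p1 p2 \<circ> transpose (opp M p1) (opp M p2) in
     \<lparr>darts = darts M, opp = t \<circ> opp M, rot = rot M \<circ> t\<rparr>)"

locale double_edge =
  fixes M :: "'d cmap" and p1 p2 :: 'd
  assumes Q: "plane_quadrangulation M"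
    and p1: "p1 \<in> darts M" and p2: "p2 \<in> darts M" and p_neq: "p1 \<noteq> p2"
    and origin: "vert M p1 = vert M p2" and target: "vert M (opp M p1) = vert M (opp M p2)"
    and no_loop: "vert M p1 \<noteq> vert M (opp M p1)"
begin

definition "q1 = opp M p1"
definition "q2 = opp M p2"
definition "t = transpose p1 p2 \<circ> transpose q1 q2"
abbreviation "C \<equiv> cut M p1 p2"

lemma M: "premap M"
  and transitive: "transitive_map M"
  and faces4: "d \<in> darts M \<Longrightarrow> card (orbit (fnext M) d) = 4"
  and vertices: "4 * card (orbit (rot M) ` darts M) = card (darts M) + 8"
  using Q unfolding plane_quadrangulation_iff by auto

lemma distinct4: "p1 \<noteq> p2" "p1 \<noteq> q1" "p1 \<noteq> q2" "p2 \<noteq> q1" "p2 \<noteq> q2" "q1 \<noteq> q2"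
    "p2 \<noteq> p1" "q1 \<noteq> p1" "q2 \<noteq> p1" "q1 \<noteq> p2" "q2 \<noteq> p2" "q2 \<noteq> q1"
  using p_neq origin target no_loop opp_eq[OF M] unfolding q1_def q2_def by metis+

lemma q_in: "q1 \<in> darts M" "q2 \<in> darts M"
  using p1 p2 by (simp_all add: q1_def q2_def opp_in[OF M])

lemma opps: "opp M p1 = q1" "opp M p2 = q2" "opp M q1 = p1" "opp M q2 = p2"
  by (simp_all add: q1_def q2_def opp_opp[OF M])

lemma t_simps: "t p1 = p2" "t p2 = p1" "t q1 = q2" "t q2 = q1"
    "x \<notin> {p1, p2, q1, q2} \<Longrightarrow> t x = x"
  using distinct4 by (auto simp: t_def transpose_def)

lemma t_t: "t (t x) = x"
  by (cases "x \<in> {p1, p2, q1, q2}") (auto simp: t_simps)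

lemma t_opp: "opp M (t x) = t (opp M x)"
proof (cases "x \<in> {p1, p2, q1, q2}")
  case False
  then have "opp M x \<notin> {p1, p2, q1, q2}" using opp_flip[OF M, of x] opps by auto
  then show ?thesis using False by (simp add: t_simps)
qed (auto simp: t_simps opps)

lemma cut_simps: "darts C = darts M" "opp C x = t (opp M x)" "rot C x = rot M (t x)" "fnext C = fnext M"
proof -
  have C: "C = \<lparr>darts = darts M, opp = t \<circ> opp M, rot = rot M \<circ> t\<rparr>"
    unfolding cut_def t_def q1_def q2_def Let_def ..
  show "darts C = darts M" "opp C x = t (opp M x)" "rot C x = rot M (t x)" "fnext C = fnext M"
    by (simp_all add: C fnext_def fun_eq_iff t_t)
qed

lemma rot_cut: "rot C = rot M \<circ> transpose p1 p2 \<circ> transpose q1 q2"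
  by (auto simp: cut_simps t_def)

lemma t_permutes: "t permutes darts M"
  unfolding t_def by (simp add: permutes_compose permutes_swap_id p1 p2 q_in)

lemma cut_premap: "premap C"
  unfolding premap_def
proof (intro conjI ballI)
  show "finite (darts C)" using premap_finite[OF M] by (simp add: cut_simps)
  have *: "opp C = t \<circ> opp M" "rot C = rot M \<circ> t" by (auto simp: cut_simps)
  show "opp C permutes darts C" "rot C permutes darts C"
    unfolding * cut_simps(1) using t_permutes premap_opp[OF M] premap_rot[OF M]
    by (simp_all add: permutes_compose)
  fix d assume d: "d \<in> darts C"
  then have d: "d \<in> darts M" by (simp add: cut_simps)
  show "opp C (opp C d) = d" unfolding cut_simps by (simp add: t_opp t_t opp_opp[OF M])
  show "opp C d \<noteq> d" unfolding cut_simps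
  proof
    assume "t (opp M d) = d"
    then have *: "opp M d = t d" using t_t by metis
    show False
    proof (cases "d \<in> {p1, p2, q1, q2}")
      case True then show False using * opps t_simps distinct4 by auto
    next
      case False then show False using * t_simps(5)[of d] opp_neq[OF M d] by simp
    qed
  qed
qed

lemma q_notin_vert: "q1 \<notin> vert M p1" "q2 \<notin> vert M p1" "p1 \<notin> vert M q1" "p2 \<notin> vert M q1"
  using no_loop origin target unfolding q1_def q2_def vert_eq_iff[OF M, symmetric] by auto

lemma cut_vertices: "card (orbit (rot C) ` darts M) = card (orbit (rot M) ` darts M) + 2"
proof -
  let ?s = "rot M \<circ> transpose p1 p2"
  have s: "?s permutes darts M"
    using premap_rot[OF M] p1 p2 by (simp add: permutes_compose permutes_swap_id)
  have 1: "card (orbit ?s ` darts M) = Suc (card (orbit (rot M) ` darts M))"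
    by (rule card_orbits_split[OF premap_rot[OF M] premap_finite[OF M] p1 p2 _ p_neq])
      (use origin vert_eq_iff[OF M] in \<open>metis vert_def\<close>)
  have "orbit ?s q1 = orbit (rot M) q1"
    by (rule orbit_transpose_other[OF rot_perm[OF M]]) (use q_notin_vert in \<open>auto simp: vert_def\<close>)
  moreover have "q2 \<in> orbit (rot M) q1"
    using target vert_eq_iff[OF M] unfolding q1_def q2_def by (metis vert_def)
  ultimately have "q2 \<in> orbit ?s q1" by simp
  from card_orbits_split[OF s premap_finite[OF M] q_in this distinct4(6)] 1
  show ?thesis by (simp add: rot_cut)
qed

lemma closed_both:
  assumes X: "closed_in C X" "p1 \<in> X" "p2 \<in> X"
  shows "X = darts M"
proof -
  note iff = closed_in_iff[OF cut_premap X(1)]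
  have "q1 \<in> X" "q2 \<in> X" using iff(2)[of p1] iff(2)[of p2] X by (auto simp: cut_simps opps t_simps)
  then have t: "t x \<in> X \<longleftrightarrow> x \<in> X" for x
    using X by (cases "x \<in> {p1, p2, q1, q2}") (auto simp: t_simps)
  have "opp M x \<in> X \<longleftrightarrow> x \<in> X" "rot M x \<in> X \<longleftrightarrow> x \<in> X" for x
    using iff(1)[of "t x"] iff(2)[of x] t by (simp_all add: cut_simps t_t)
  then have "closed_in M X" using X(1) by (auto simp: closed_in_def cut_simps)
  then show ?thesis using transitive X by (auto simp: transitive_map_iff_closed)
qed

lemma closed_one:
  assumes X: "closed_in C X" "X \<noteq> {}" "X \<noteq> darts M"
  shows "p1 \<in> X \<longleftrightarrow> p2 \<notin> X"
proof -
  have "closed_in C (darts M - X)"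
    using closed_in_Diff[OF cut_premap closed_in_darts[OF cut_premap] X(1)] by (simp add: cut_simps)
  moreover have "darts M - X \<noteq> darts M" using closed_in_subset[OF X(1)] X(2) by (auto simp: cut_simps)
  ultimately show ?thesis using closed_both[of "darts M - X"] closed_both[OF X(1)] X(3) p1 p2 by auto
qed

lemma component:
  assumes X: "closed_in C X" "X \<noteq> {}" "X \<noteq> darts M"
  shows "premap (submap X C)" "transitive_map (submap X C)"
    "\<And>d. d \<in> X \<Longrightarrow> card (orbit (fnext (submap X C)) d) = 4"
    "4 * card (orbit (rot C) ` X) \<le> card X + 8"
proof -
  note C = cut_premap
  show pre: "premap (submap X C)" by (rule submap_premap[OF C X(1)])
  show tr: "transitive_map (submap X C)"
  proof (rule submap_transitive[OF C X(1)])
    fix Y assume Y: "closed_in C Y" "Y \<noteq> {}" "Y \<subseteq> X"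
    have "X \<subseteq> darts M" using closed_in_subset[OF X(1)] by (auto simp: cut_simps)
    then have "Y \<noteq> darts M" "X - Y \<noteq> darts M" using X Y by auto
    then have 1: "p1 \<in> Y \<longleftrightarrow> p2 \<notin> Y" using closed_one Y by blast
    have 2: "p1 \<in> X - Y \<longleftrightarrow> p2 \<notin> X - Y" if "X - Y \<noteq> {}"
      by (rule closed_one[OF closed_in_Diff[OF C X(1) Y(1)] that]) fact
    have "p1 \<in> X \<longleftrightarrow> p2 \<notin> X" by (rule closed_one[OF X])
    then have "X - Y = {}" using 1 2 Y(3) by blast
    then show "Y = X" using Y by auto
  qed
  have sub: "X \<subseteq> darts M" using closed_in_subset[OF X(1)] by (auto simp: cut_simps)
  show F: "card (orbit (fnext (submap X C)) d) = 4" if "d \<in> X" for d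
    using that submap_orbits[OF C X(1)] faces4 sub by (auto simp: cut_simps)
  have "4 * card (orbit (fnext (submap X C)) ` X) = card X"
    using card_orbits_uniform[OF fnext_permutes[OF pre] premap_finite[OF pre]] F
    by (simp add: submap_simps[OF C X(1)])
  moreover have "orbit (rot (submap X C)) ` X = orbit (rot C) ` X"
    using submap_orbits[OF C X(1)] by (intro image_cong) auto
  ultimately show "4 * card (orbit (rot C) ` X) \<le> card X + 8"
    using Euler_inequality[OF pre tr] X(2) by (simp add: submap_simps[OF C X(1)])
qed

lemma exists_component:
  assumes e: "e \<in> darts M"
  obtains X where "closed_in C X" "e \<notin> X" "p1 \<in> X \<longleftrightarrow> p2 \<notin> X" "plane_quadrangulation (submap X C)"
proof -
  note C = cut_premap
  have "\<not> transitive_map C"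
  proof
    assume t: "transitive_map C"
    have "4 * card (orbit (fnext M) ` darts M) = card (darts M)"
      using card_orbits_uniform[OF fnext_permutes[OF M] premap_finite[OF M]] faces4 by blast
    then show False
      using Euler_inequality[OF C t] p1 vertices by (auto simp: cut_simps cut_vertices)
  qed
  then obtain X where X: "closed_in C X" "X \<noteq> {}" "X \<noteq> darts M"
    unfolding transitive_map_iff_closed by (auto simp: cut_simps)
  define Y where "Y = darts M - X"
  have XD: "X \<subseteq> darts M" using closed_in_subset[OF X(1)] by (auto simp: cut_simps)
  have Y: "closed_in C Y" "Y \<noteq> {}" "Y \<noteq> darts M"
    using closed_in_Diff[OF C closed_in_darts[OF C] X(1)] X XD by (auto simp: cut_simps Y_def)
  have fin: "finite (darts M)" "finite X" "finite Y"
    using premap_finite[OF M] XD by (auto simp: Y_def finite_subset)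
  have "orbit (rot C) ` darts M = orbit (rot C) ` X \<union> orbit (rot C) ` Y"
    using XD by (auto simp: Y_def)
  moreover have "orbit (rot C) ` X \<inter> orbit (rot C) ` Y = {}"
    using closed_in_orbit(1)[OF C X(1)] closed_in_orbit(1)[OF C Y(1)]
    permutation_self_in_orbit[OF rot_perm[OF C]] by (fastforce simp: Y_def)
  ultimately have "card (orbit (rot C) ` darts M) = card (orbit (rot C) ` X) + card (orbit (rot C) ` Y)"
    using fin by (simp add: card_Un_disjoint)
  moreover have "card (darts M) = card X + card Y"
    using XD fin by (simp add: Y_def card_Diff_subset card_mono)
  ultimately have "4 * card (orbit (rot C) ` X) = card X + 8" "4 * card (orbit (rot C) ` Y) = card Y + 8"
    using component(4)[OF X] component(4)[OF Y] cut_vertices vertices by simp_all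
  moreover have "orbit (rot (submap X C)) ` X = orbit (rot C) ` X" "orbit (rot (submap Y C)) ` Y = orbit (rot C) ` Y"
    using submap_orbits[OF C X(1)] submap_orbits[OF C Y(1)] by auto
  ultimately have "plane_quadrangulation (submap X C)" "plane_quadrangulation (submap Y C)"
    using component[OF X] component[OF Y] unfolding plane_quadrangulation_iff
    by (auto simp: submap_simps[OF C X(1)] submap_simps[OF C Y(1)])
  moreover have "p1 \<in> X \<longleftrightarrow> p2 \<notin> X" "p1 \<in> Y \<longleftrightarrow> p2 \<notin> Y"
    using closed_one[OF X] closed_one[OF Y] .
  moreover have "e \<notin> X \<or> e \<notin> Y" by (auto simp: Y_def)
  ultimately show ?thesis using that X(1) Y(1) by blast
qed

lemma swap: "double_edge M p2 p1" "cut M p2 p1 = C"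
proof -
  show "double_edge M p2 p1"
    by unfold_locales (use Q p1 p2 p_neq origin target no_loop in auto)
  show "cut M p2 p1 = C" unfolding cut_def by (simp add: transpose_commute)
qed

context
  fixes A
  assumes A: "closed_in C A" "p1 \<notin> A" "p2 \<in> A"
begin

abbreviation "N \<equiv> submap A C"

lemma A_sub: "A \<subseteq> darts M" using closed_in_subset[OF A(1)] by (simp add: cut_simps)

lemma qA: "q1 \<in> A" "q2 \<notin> A"
  using closed_in_iff(2)[OF cut_premap A(1), of p2] closed_in_iff(2)[OF cut_premap A(1), of p1] A
  by (auto simp: cut_simps opps t_simps)

lemma N_simps: "darts N = A" "x \<in> A \<Longrightarrow> rot N x = rot M (t x)" "x \<in> A \<Longrightarrow> opp N x = t (opp M x)"
  "x \<in> A \<Longrightarrow> fnext N x = fnext M x" "x \<in> A \<Longrightarrow> vert N x = vert C x"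
  unfolding vert_def using submap_simps[OF cut_premap A(1)] submap_orbits[OF cut_premap A(1)]
  by (simp_all add: cut_simps)

lemma vert_C_inter: "x \<in> A \<Longrightarrow> vert C x \<subseteq> A"
  using closed_in_orbit(1)[OF cut_premap A(1)] by (simp add: vert_def)

lemma vert_C_inter': "x \<in> darts M \<Longrightarrow> x \<notin> A \<Longrightarrow> vert C x \<inter> A = {}"
  using closed_in_orbit(1)[OF cut_premap closed_in_Diff[OF cut_premap closed_in_darts[OF cut_premap] A(1)], of x]
  by (auto simp: vert_def cut_simps)

lemma vert_C_sub: "vert C x \<subseteq> vert M x"
  unfolding vert_def
proof (rule orbit_subsetI)
  have *: "vert M (t y) = vert M y" for y
    by (cases "y \<in> {p1, p2, q1, q2}") (use origin target[folded q1_def q2_def] in \<open>auto simp: t_simps\<close>)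
  have **: "vert M (rot C y) = vert M y" for y by (simp add: cut_simps vert_rot[OF M] *)
  show "x \<in> orbit (rot M) x" using vert_self[OF M] by (metis vert_def)
  show "rot C y \<in> orbit (rot M) x" if "y \<in> orbit (rot M) x" for y
    using that ** by (metis vert_def vert_eq_iff[OF M])
qed

lemma vert_transfer:
  assumes xy: "x \<in> A" "y \<in> A" and eq: "vert M x = vert M y"
  shows "vert C x = vert C y"
proof -
  have split: "vert M a \<subseteq> vert C a \<union> vert C b"
    if ab: "(a, b) \<in> {(p1, p2), (q1, q2), (p2, p1), (q2, q1)}" for a b
    unfolding vert_def[of M]
  proof (rule orbit_subsetI)
    show "a \<in> vert C a \<union> vert C b" using vert_self[OF cut_premap] by auto
    fix z assume z: "z \<in> vert C a \<union> vert C b"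
    show "rot M z \<in> vert C a \<union> vert C b"
    proof (cases "z \<in> {p1, p2, q1, q2}")
      case True
      have "vert C a \<union> vert C b \<subseteq> vert M a" using vert_C_sub[of a] vert_C_sub[of b] ab origin target
        by (auto simp: q1_def q2_def)
      then have "z \<in> vert M a" using z by blast
      then have "z = a \<or> z = b" using True ab q_notin_vert origin target[folded q1_def q2_def] by auto
      then have "t z = a \<or> t z = b" "t z \<in> vert C a \<union> vert C b"
        using ab vert_self[OF cut_premap] by (auto simp: t_simps)
      moreover have "rot M z = rot C (t z)" by (simp add: cut_simps t_t)
      ultimately show ?thesis by (auto simp: vert_def intro: orbit.intros)
    next
      case False
      then have "rot M z = rot C z" by (simp add: cut_simps t_simps)
      then show ?thesis using z by (auto simp: vert_def intro: orbit.step)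
    qed
  qed
  have in_A: "vert C z = vert C a" if z: "z \<in> A" "z \<in> vert M a" "a \<in> A" "b \<in> darts M" "b \<notin> A"
    and ab: "(a, b) \<in> {(p1, p2), (q1, q2), (p2, p1), (q2, q1)}" for a b z
    using split[OF ab] z vert_C_inter'[of b] vert_eq_iff[OF cut_premap, of z a] by blast
  have p: "vert C z = vert C p2" if "z \<in> A" "z \<in> vert M p2" for z
    by (rule in_A[OF that A(3) p1 A(2)]) simp
  have q: "vert C z = vert C q1" if "z \<in> A" "z \<in> vert M q1" for z
    by (rule in_A[OF that qA(1) q_in(2) qA(2)]) simp
  consider "p2 \<in> vert M x" | "q1 \<in> vert M x" | "p2 \<notin> vert M x" "q1 \<notin> vert M x" by blast
  then show ?thesis
  proof cases
    case 1 then show ?thesis using p[of x] p[of y] xy eq vert_eq_iff[OF M] by metis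
  next
    case 2 then show ?thesis using q[of x] q[of y] xy eq vert_eq_iff[OF M] by metis
  next
    case 3
    then have n: "{p1, p2, q1, q2} \<inter> vert M x = {}"
      using origin target[folded q1_def q2_def] vert_eq_iff[OF M] by (metis Int_insert_left_if0 Int_empty_left)
    have "orbit (rot C) x = orbit (rot M) x"
    proof (rule orbit_cong[OF permutation_self_in_orbit[OF rot_perm[OF M]]])
      fix z assume "z \<in> orbit (rot M) x"
      then have "z \<notin> {p1, p2, q1, q2}" using n by (auto simp: vert_def)
      then show "rot C z = rot M z" by (simp add: cut_simps t_simps)
    qed
    then have "y \<in> vert C x" using eq vert_eq_iff[OF M] unfolding vert_def by metis
    then show ?thesis using vert_eq_iff[OF cut_premap] by metis
  qed
qed

end

end

subsection \<open>Reducible vertices\<close>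

definition reducible :: "'d cmap \<Rightarrow> 'd \<Rightarrow> bool" where
  "reducible M d \<longleftrightarrow> (let r = rot M; a = opp M; f = fnext M in
     r d = d \<or>
     r (r d) = d \<and> vert M (a d) \<noteq> vert M (a (r d)) \<or>
     r (r (r d)) = d \<and>
       distinct (map (vert M) [a d, a (r d), a (r (r d)), f (f d), f (f (r d)), f (f (r (r d)))]))"

context double_edge
begin

lemma reducible_transfer:
  assumes A: "closed_in C A" "p1 \<notin> A" "p2 \<in> A"
    and d: "d \<in> A" "reducible (submap A C) d"
      "vert (submap A C) d \<noteq> vert (submap A C) p2" "vert (submap A C) d \<noteq> vert (submap A C) (opp (submap A C) p2)"
  shows "reducible M d" "vert M d = vert C d" "vert C d \<subseteq> A - {p2, q1}"
proof -
  let ?N = "submap A C"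
  note N = N_simps[OF A] and C = cut_premap and qA = qA[OF A]
  note iff = closed_in_iff[OF C A(1)]
  have oq: "opp ?N p2 = q1" using N(3)[OF A(3)] by (simp add: opps t_simps)
  have nq: "p2 \<notin> vert C d" "q1 \<notin> vert C d"
    using d(3,4) N(5) d(1) A(3) qA(1) vert_eq_iff[OF C] unfolding oq by metis+
  have sub: "vert C d \<subseteq> A" using vert_C_inter[OF A d(1)] .
  then show "vert C d \<subseteq> A - {p2, q1}" using nq by blast
  then have avoid: "y \<notin> {p1, p2, q1, q2}" if "y \<in> vert C d" for y using that A(2) qA by auto
  have t: "t y = y" if "y \<in> vert C d" for y using avoid[OF that] t_simps(5) by blast
  have rC: "rot C y = rot M y" if "y \<in> vert C d" for y using t[OF that] by (simp add: cut_simps)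
  show vd: "vert M d = vert C d"
    unfolding vert_def
    by (rule orbit_cong[OF permutation_self_in_orbit[OF rot_perm[OF C]]])
      (use rC in \<open>simp add: vert_def\<close>)
  have mem: "d \<in> vert C d" "rot M d \<in> vert C d" "rot M (rot M d) \<in> vert C d"
    using vd vert_self[OF M] vert_rot[OF M] by metis+
  have rN: "rot ?N y = rot M y" if "y \<in> vert C d" for y
    using N(2) that t sub by auto
  have oN: "opp ?N y = opp M y" if "y \<in> vert C d" for y
  proof -
    have "opp M y \<notin> {p1, p2, q1, q2}" using avoid[OF that] opp_flip[OF M, of y] opps by auto
    then show ?thesis using N(3) that sub t_simps(5) by auto
  qed
  have fA: "fnext M y \<in> A \<longleftrightarrow> y \<in> A" for y using iff(3) by (simp add: cut_simps)
  have fN: "fnext ?N y = fnext M y" if "y \<in> A" for y using N(4) that by simp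
  have memA: "d \<in> A" "rot M d \<in> A" "rot M (rot M d) \<in> A" using mem sub by auto
  have oA: "opp M y \<in> A" if "y \<in> vert C d" for y
    using oN[OF that] closed_in_iff(2)[OF submap_premap[OF C A(1)] closed_in_darts[OF submap_premap[OF C A(1)]]]
      N(1) sub that by (metis subsetD)
  have vN: "vert M x \<noteq> vert M y" if "vert ?N x \<noteq> vert ?N y" "x \<in> A" "y \<in> A" for x y
    using vert_transfer[OF A] that N(5) by metis
  let ?l = "[opp M d, opp M (rot M d), opp M (rot M (rot M d)),
    fnext M (fnext M d), fnext M (fnext M (rot M d)), fnext M (fnext M (rot M (rot M d)))]"
  have "distinct (map (vert ?N) xs) \<longrightarrow> set xs \<subseteq> A \<longrightarrow> distinct (map (vert M) xs)" for xs
    unfolding distinct_map inj_on_def using vN by (meson subsetD)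
  moreover have "set ?l \<subseteq> A" using oA mem memA by (simp add: fA)
  ultimately have l: "distinct (map (vert ?N) ?l) \<Longrightarrow> distinct (map (vert M) ?l)" by blast
  have N_d: "rot ?N d = rot M d" "rot ?N (rot M d) = rot M (rot M d)"
    "rot ?N (rot M (rot M d)) = rot M (rot M (rot M d))" "opp ?N d = opp M d"
    "opp ?N (rot M d) = opp M (rot M d)" "opp ?N (rot M (rot M d)) = opp M (rot M (rot M d))"
    "fnext ?N (fnext ?N d) = fnext M (fnext M d)"
    "fnext ?N (fnext ?N (rot M d)) = fnext M (fnext M (rot M d))"
    "fnext ?N (fnext ?N (rot M (rot M d))) = fnext M (fnext M (rot M (rot M d)))"
    by (simp_all add: rN[OF mem(1)] rN[OF mem(2)] rN[OF mem(3)] oN[OF mem(1)] oN[OF mem(2)] oN[OF mem(3)]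
        fN[OF memA(1)] fN[OF memA(2)] fN[OF memA(3)] fN fA memA)
  from d(2) consider "rot M d = d"
    | "rot M (rot M d) = d" "vert ?N (opp M d) \<noteq> vert ?N (opp M (rot M d))"
    | "rot M (rot M (rot M d)) = d" "distinct (map (vert ?N) ?l)"
    unfolding reducible_def Let_def N_d by blast
  then show "reducible M d"
  proof cases
    case 1 then show ?thesis by (simp add: reducible_def)
  next
    case 2 then show ?thesis using vN oA mem unfolding reducible_def Let_def by blast
  next
    case 3 then show ?thesis using l unfolding reducible_def Let_def by blast
  qed
qed

end

lemma vert_colour:
  assumes M: "premap M" and c: "colouring M c" and "x \<in> darts M" "y \<in> vert M x"
  shows "c y = c x"
proof -
  have "y \<in> darts M \<and> c y = c x" using assms(4) unfolding vert_def
    by induction (use c assms(3) rot_in[OF M] in \<open>auto simp: colouring_def\<close>)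
  then show ?thesis ..
qed

lemma colouring_neq:
  assumes "premap M" "colouring M c" "x \<in> darts M" "y \<in> darts M" "c x \<noteq> c y"
  shows "vert M x \<noteq> vert M y"
  using assms vert_colour vert_self by metis

lemma colour_step:
  assumes M: "premap M" "colouring M c" and d: "d \<in> darts M"
  shows "c (opp M d) = (\<not> c d)" "c (rot M d) = c d" "c (fnext M d) = (\<not> c d)"
  using assms unfolding colouring_def fnext_def by (auto simp: opp_in)

lemma card_orbit_cases:
  assumes f: "permutation f" and c: "card (orbit f x) \<le> 3"
  shows "card (orbit f x) = 1 \<and> f x = x \<or> card (orbit f x) = 2 \<and> f (f x) = x \<and> f x \<noteq> x \<or>
    card (orbit f x) = 3 \<and> f (f (f x)) = x \<and> distinct [x, f x, f (f x)]"
proof -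
  let ?n = "funpow_dist1 f x x"
  have self: "x \<in> orbit f x" using f by (rule permutation_self_in_orbit)
  have card: "card (orbit f x) = ?n"
    unfolding orbit_conv_funpow_dist1[OF self] using inj_on_funpow_dist1[OF self]
    by (simp add: card_image)
  have r: "(f ^^ ?n) x = x" by (rule funpow_dist1_prop[OF self])
  have l: "(f ^^ m) x \<noteq> x" if "0 < m" "m < ?n" for m using funpow_dist1_least[OF that] .
  have inj: "f a = f b \<longleftrightarrow> a = b" for a b
    using f by (metis bij_pointE permutation_bijective)
  consider "?n = 1" | "?n = 2" | "?n = 3" using c card by linarith
  then show ?thesis
  proof cases
    case 1 then show ?thesis using r card unfolding 1 by simp
  next
    case 2 then show ?thesis using r l[of 1] card unfolding 2 by (simp add: eval_nat_numeral)
  next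
    case 3 then show ?thesis using r l[of 1] l[of 2] card unfolding 3 by (auto simp: eval_nat_numeral inj)
  qed
qed

text \<open>Since the degrees \<open>deg\<close> satisfy \<open>\<Sum>(4 - deg) = 8\<close>, and an irreducible vertex of degree 3 has a
  neighbour of degree at most 2, the two ends of \<open>e\<close> cannot account for the whole sum.\<close>

lemma reducible_simple:
  assumes Q: "plane_quadrangulation M" and e: "e \<in> darts M"
    and simple: "\<And>x y. x \<in> darts M \<Longrightarrow> y \<in> darts M \<Longrightarrow> vert M x = vert M y \<Longrightarrow>
      vert M (opp M x) = vert M (opp M y) \<Longrightarrow> x = y"
  shows "\<exists>d\<in>darts M. reducible M d \<and> vert M d \<noteq> vert M e \<and> vert M d \<noteq> vert M (opp M e)"
proof (rule ccontr)
  assume neg: "\<not> ?thesis"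
  have M: "premap M"
    and F: "\<And>d. d \<in> darts M \<Longrightarrow> card (orbit (fnext M) d) = 4"
    and V: "4 * card (orbit (rot M) ` darts M) = card (darts M) + 8"
    using Q unfolding plane_quadrangulation_iff by auto
  obtain c where c: "colouring M c" using Q by (rule bipartite)
  note col = colour_step[OF M c] and inD = opp_in[OF M] rot_in[OF M] fnext_in[OF M]
  have f4: "fnext M (fnext M (fnext M (fnext M d))) = d" if "d \<in> darts M" for d
    using F[OF that] orbit4_iff[OF fnext_perm[OF M]] by simp
  have two: "reducible M d" if d: "d \<in> darts M" and 2: "rot M (rot M d) = d" for d
  proof (cases "rot M d = d")
    case False
    then have "vert M (opp M d) \<noteq> vert M (opp M (rot M d))"
      using simple[of d "rot M d"] d vert_rot[OF M, of d] by (auto simp: inD)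
    then show ?thesis using 2 unfolding reducible_def Let_def by simp
  qed (simp add: reducible_def)
  have bad: "rot M (rot M (opp M d)) = opp M d"
    if d: "d \<in> darts M" and eq: "vert M (fnext M (fnext M d)) = vert M (fnext M (fnext M (rot M d)))" for d
  proof -
    let ?s = "fnext M d" and ?t = "opp M (fnext M (fnext M (rot M d)))"
    have rt: "rot M ?t = opp M d"
      using f4[of "opp M d"] d fnext_opp[OF M, of d] by (simp add: fnext_def inD)
    have "vert M ?t = vert M (opp M d)" using vert_rot[OF M, of ?t] rt by simp
    then have "vert M ?s = vert M ?t" using vert_fnext[OF M] by simp
    moreover have "vert M (opp M ?s) = vert M (opp M ?t)"
      using eq vert_fnext[OF M, of "fnext M d"] by (simp add: opp_opp[OF M])
    ultimately have "?s = ?t" using d by (intro simple) (simp_all add: inD)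
    then show ?thesis using rt by (simp add: fnext_def)
  qed
  let ?V = "orbit (rot M) ` darts M"
  let ?u = "vert M e" and ?w = "vert M (opp M e)"
  define nb where "nb x = (if card (vert M x) = 2 then {vert M (opp M (rot M x))} else {})" for x
  have nb3: "card (nb x) + 4 \<le> 3 + card (vert M x)" if "x \<in> darts M" for x
  proof -
    have "finite (vert M x)" using vert_subset[OF M that] premap_finite[OF M] finite_subset by blast
    then have "card (vert M x) \<noteq> 0" using vert_self[OF M] by auto
    then show ?thesis by (auto simp: nb_def)
  qed
  have neighbour: "vert M d \<in> nb x"
    if d: "d \<in> darts M" and x: "x \<in> darts M" and 2: "rot M (rot M (opp M d)) = opp M d"
      and vx: "vert M (opp M d) = vert M x" "vert M d \<noteq> vert M (opp M x)" for d x
  proof -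
    have o: "vert M (opp M d) = {opp M d, rot M (opp M d)}"
      unfolding vert_def by (rule orbit_return2[OF rot_perm[OF M] 2])
    have "x \<noteq> opp M d" using vx(2) opp_opp[OF M] by auto
    moreover have "x \<in> vert M (opp M d)" using vx vert_self[OF M] by auto
    ultimately have x': "x = rot M (opp M d)" using o by auto
    then have "opp M d = rot M x" using 2 by simp
    moreover have "card (vert M x) = 2" using o vx(1) x' \<open>x \<noteq> opp M d\<close> by auto
    ultimately show ?thesis unfolding nb_def using opp_opp[OF M] by (metis insertI1)
  qed
  have low: "3 \<le> card S \<and> (card S = 3 \<longrightarrow> S \<in> nb e \<union> nb (opp M e))"
    if S: "S \<in> ?V" "S \<noteq> ?u" "S \<noteq> ?w" for S
  proof -
    obtain d where d: "d \<in> darts M" "S = vert M d" using S by (auto simp: vert_def)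
    have nr: "\<not> reducible M y" if "y \<in> S" for y
    proof -
      have "vert M y = S" using that vert_eq_iff[OF M] d by metis
      moreover have "y \<in> darts M" using that vert_subset[OF M d(1)] d(2) by auto
      ultimately show ?thesis using neg S by metis
    qed
    have dS: "d \<in> S" using d vert_self[OF M] by auto
    have "rot M (rot M d) \<noteq> d" using two nr d dS by metis
    moreover then have "rot M d \<noteq> d" by auto
    ultimately have 3: "3 \<le> card S"
      using card_orbit_cases[OF rot_perm[OF M], of d] d unfolding vert_def
      by (metis nat_le_linear)
    have "S \<in> nb e \<union> nb (opp M e)" if "card S = 3"
    proof -
      have r3: "rot M (rot M (rot M d)) = d" "distinct [d, rot M d, rot M (rot M d)]"
        using card_orbit_cases[OF rot_perm[OF M], of d] d that unfolding vert_def by auto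
      let ?r = "rot M d" and ?q = "rot M (rot M d)"
      have vs: "vert M ?r = S" "vert M ?q = S" using d vert_rot[OF M] by auto
      have dd: "?r \<in> darts M" "?q \<in> darts M" using d by (auto simp: inD)
      have a: "vert M (opp M x) \<noteq> vert M (opp M y)" if "x \<noteq> y" "x \<in> {d, ?r, ?q}" "y \<in> {d, ?r, ?q}" for x y
        using simple[of x y] that d dd vs by auto
      have k: "vert M (opp M x) \<noteq> vert M (fnext M (fnext M y))" if "x \<in> {d, ?r, ?q}" "y \<in> {d, ?r, ?q}" for x y
        by (rule colouring_neq[OF M c]) (use that d dd in \<open>auto simp: inD col\<close>)
      have "\<not> reducible M d" using nr dS .
      then have "\<not> distinct (map (vert M) ([opp M d, opp M ?r, opp M ?q] @
          [fnext M (fnext M d), fnext M (fnext M ?r), fnext M (fnext M ?q)]))"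
        using r3(1) unfolding reducible_def Let_def append.simps by blast
      moreover have "distinct (map (vert M) [opp M d, opp M ?r, opp M ?q])"
        using a[of d ?r] a[of d ?q] a[of ?r ?q] r3(2) by simp
      moreover have "set (map (vert M) [opp M d, opp M ?r, opp M ?q]) \<inter>
          set (map (vert M) [fnext M (fnext M d), fnext M (fnext M ?r), fnext M (fnext M ?q)]) = {}"
        using k[of d d] k[of d ?r] k[of d ?q] k[of ?r d] k[of ?r ?r] k[of ?r ?q]
          k[of ?q d] k[of ?q ?r] k[of ?q ?q] by simp
      ultimately have "\<not> distinct (map (vert M) [fnext M (fnext M d), fnext M (fnext M ?r), fnext M (fnext M ?q)])"
        unfolding map_append distinct_append by blast
      then consider "vert M (fnext M (fnext M d)) = vert M (fnext M (fnext M ?r))"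
        | "vert M (fnext M (fnext M ?r)) = vert M (fnext M (fnext M ?q))"
        | "vert M (fnext M (fnext M ?q)) = vert M (fnext M (fnext M d))"
        by auto
      then obtain y where y: "y \<in> {d, ?r, ?q}"
          "vert M (fnext M (fnext M y)) = vert M (fnext M (fnext M (rot M y)))"
        using r3(1) by cases (metis insertI1, metis insertI1 insertI2, metis insertI1 insertI2)
      have yD: "y \<in> darts M" "vert M y = S" using y d dd vs by auto
      have 2: "rot M (rot M (opp M y)) = opp M y" using bad yD y by blast
      then have "reducible M (opp M y)" using two yD by (simp add: inD)
      then have "vert M (opp M y) = ?u \<or> vert M (opp M y) = ?w"
        using neg yD inD by blast
      then show ?thesis
        using neighbour[OF yD(1) e 2] neighbour[OF yD(1) _ 2, of "opp M e"] S yD(2) e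
        by (auto simp: inD opp_opp[OF M])
    qed
    with 3 show ?thesis by simp
  qed
  have fin: "finite ?V" using premap_finite[OF M] by simp
  have uw: "?u \<in> ?V" "?w \<in> ?V" using e inD by (auto simp: vert_def)
  have "?u \<noteq> ?w" by (rule colouring_neq[OF M c]) (use e in \<open>auto simp: inD col\<close>)
  define W where "W = ?V - {?u, ?w}"
  have V_eq: "?V = insert ?u (insert ?w W)" "?u \<notin> insert ?w W" "?w \<notin> W" "finite W"
    using uw \<open>?u \<noteq> ?w\<close> fin by (auto simp: W_def)
  let ?Z = "{S \<in> W. card S = 3}"
  have "?Z \<subseteq> nb e \<union> nb (opp M e)" using low unfolding W_def by blast
  moreover have "finite (nb x)" for x by (simp add: nb_def)
  ultimately have Z: "card ?Z \<le> card (nb e) + card (nb (opp M e))"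
    by (meson card_Un_le card_mono finite_UnI le_trans)
  have "(\<Sum>S\<in>W. 4) \<le> (\<Sum>S\<in>W. card S + (if card S = 3 then 1 else 0))"
    by (rule sum_mono) (use low in \<open>fastforce simp: W_def\<close>)
  also have "\<dots> = (\<Sum>S\<in>W. card S) + card ?Z"
    using V_eq(4) by (simp add: sum.distrib sum.If_cases Int_def conj_commute)
  finally have "4 * card W \<le> (\<Sum>S\<in>W. card S) + card ?Z" by simp
  moreover have "(\<Sum>S\<in>?V. card S) = card (darts M)"
    by (rule sum_card_orbits[OF premap_rot[OF M] premap_finite[OF M]])
  then have "card ?u + card ?w + (\<Sum>S\<in>W. card S) = card (darts M)"
    unfolding V_eq(1) using V_eq by simp
  moreover have "card ?V = card W + 2" using V_eq by simp
  moreover have "card (nb e) + 4 \<le> 3 + card ?u" "card (nb (opp M e)) + 4 \<le> 3 + card ?w"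
    using nb3 e by (simp_all add: inD)
  ultimately show False using Z V by linarith
qed

lemma exists_reducible:
  assumes "plane_quadrangulation M" "e \<in> darts M"
  shows "\<exists>d\<in>darts M. reducible M d \<and> vert M d \<noteq> vert M e \<and> vert M d \<noteq> vert M (opp M e)"
  using assms
proof (induction "card (darts M)" arbitrary: M e rule: less_induct)
  case less
  note Q = less.prems(1) and e = less.prems(2)
  have M: "premap M" using Q unfolding plane_quadrangulation_iff by auto
  obtain c where c: "colouring M c" using Q by (rule bipartite)
  show ?case
  proof (cases "\<exists>x\<in>darts M. \<exists>y\<in>darts M. x \<noteq> y \<and> vert M x = vert M y \<and> vert M (opp M x) = vert M (opp M y)")
    case False
    then show ?thesis using reducible_simple[OF Q e] by metis
  next
    case True
    then obtain x y where xy: "x \<in> darts M" "y \<in> darts M" "x \<noteq> y" "vert M x = vert M y"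
      "vert M (opp M x) = vert M (opp M y)" by blast
    have "vert M x \<noteq> vert M (opp M x)"
      by (rule colouring_neq[OF M c]) (use xy colour_step[OF M c] opp_in[OF M] in auto)
    then have de: "double_edge M x y" using Q xy by unfold_locales auto
    from double_edge.exists_component[OF de e] obtain X where
      X: "closed_in (cut M x y) X" "e \<notin> X" "x \<in> X \<longleftrightarrow> y \<notin> X" "plane_quadrangulation (submap X (cut M x y))"
      by blast
    obtain p1 p2 where de: "double_edge M p1 p2"
      and X: "closed_in (cut M p1 p2) X" "e \<notin> X" "p1 \<notin> X" "p2 \<in> X" "plane_quadrangulation (submap X (cut M p1 p2))"
      using de double_edge.swap[OF de] X by metis
    interpret double_edge M p1 p2 by (rule de)
    let ?N = "submap X C"
    note A = X(1,3,4)
    have dN: "darts ?N = X" by (simp add: submap_def)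
    have "card X < card (darts M)"
      using A_sub[OF A] X(3) p1 premap_finite[OF M] by (intro psubset_card_mono) auto
    with less.hyps[of ?N p2] X(4,5) obtain d where d: "d \<in> X" "reducible ?N d"
      "vert ?N d \<noteq> vert ?N p2" "vert ?N d \<noteq> vert ?N (opp ?N p2)"
      unfolding dN by blast
    note tr = reducible_transfer[OF A d]
    have "d \<in> darts M" using d(1) A_sub[OF A] by auto
    moreover have "x \<notin> X \<Longrightarrow> vert M d \<noteq> vert M x" for x using tr vert_self[OF M] by blast
    moreover have "vert M d \<noteq> vert M (opp M e)"
    proof -
      have "opp M e \<notin> vert M d"
      proof
        assume *: "opp M e \<in> vert M d"
        then have "opp M e \<in> X" "opp M e \<notin> {p1, p2, q1, q2}"
          using tr A qA[OF A] by auto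
        then have e4: "e \<notin> {p1, p2, q1, q2}" using opps opp_flip[OF M, of e] by auto
        have "opp C (opp M e) = e"
          using e4 by (simp add: cut_simps opp_opp[OF M] t_simps)
        then show False using closed_in_iff(2)[OF cut_premap A(1), of "opp M e"] \<open>opp M e \<in> X\<close> X(2) by simp
      qed
      then show ?thesis using vert_self[OF M] by metis
    qed
    ultimately show ?thesis using tr(1) X(2) by blast
  qed
qed

subsection \<open>Deleting edges\<close>

definition skip :: "'a \<Rightarrow> ('a \<Rightarrow> 'a) \<Rightarrow> 'a \<Rightarrow> 'a" where
  "skip e f = (\<lambda>x. if x = e then e else if f x = e then f e else f x)"

lemma skip_eq_comp: "inj f \<Longrightarrow> skip e f = transpose e (f e) \<circ> f"
  by (auto simp: skip_def fun_eq_iff transpose_def dest: injD)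

lemma skip_permutes:
  assumes f: "f permutes D" and e: "e \<in> D"
  shows "skip e f permutes (D - {e})"
proof -
  have "inj f" using f by (rule permutes_inj)
  then have "skip e f permutes D"
    using e f by (simp add: skip_eq_comp permutes_compose permutes_swap_id permutes_in_image)
  then show ?thesis by (rule permutes_superset) (use e in \<open>auto simp: skip_def\<close>)
qed

lemma skip_orbit:
  assumes f: "permutation f" and x: "x \<noteq> e"
  shows "orbit (skip e f) x = orbit f x - {e}"
proof
  have inj: "f a = f b \<longleftrightarrow> a = b" for a b
    using f by (metis bij_pointE permutation_bijective)
  show "orbit (skip e f) x \<subseteq> orbit f x - {e}"
    by (rule orbit_subsetI)
      (use x permutation_self_in_orbit[OF f] in \<open>auto simp: skip_def inj intro: orbit.step\<close>)
  have "y \<in> orbit f x \<Longrightarrow> (y \<noteq> e \<longrightarrow> y \<in> orbit (skip e f) x) \<and> (y = e \<longrightarrow> f e \<in> orbit (skip e f) x)" for y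
  proof (induction rule: orbit.induct)
    case base
    have "skip e f x \<in> orbit (skip e f) x" by (rule orbit.base)
    then show ?case using x by (auto simp: skip_def inj split: if_splits)
  next
    case (step y)
    then show ?case
      using orbit.step[of y "skip e f" x] by (cases "y = e") (auto simp: skip_def inj split: if_splits)
  qed
  then show "orbit f x - {e} \<subseteq> orbit (skip e f) x" by blast
qed

lemma card_orbits_fixpoint:
  assumes f: "f permutes D" and D: "finite D" "e \<in> D" "f e = e"
  shows "card (orbit f ` D) = Suc (card (orbit f ` (D - {e})))"
proof -
  have p: "permutation f" using f D by (simp add: permutes_permutation)
  have e: "orbit f e = {e}" using D(3) by (simp add: orbit_eq_singleton_iff)
  have "orbit f ` D = insert {e} (orbit f ` (D - {e}))" using D(2) e by blast
  moreover have "{e} \<notin> orbit f ` (D - {e})" using permutation_self_in_orbit[OF p] by auto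
  ultimately show ?thesis using D(1) by simp
qed

lemma card_orbits_skip:
  assumes f: "f permutes D" and D: "finite D" "e \<in> D"
  shows "card (orbit (skip e f) ` (D - {e})) + (if f e = e then 1 else 0) = card (orbit f ` D)"
proof (cases "f e = e")
  case True
  have "inj f" using f by (rule permutes_inj)
  then have "skip e f = f" using True by (auto simp: skip_def fun_eq_iff dest: injD)
  then show ?thesis using card_orbits_fixpoint[OF f D True] True by simp
next
  case False
  have inj: "inj f" using f by (rule permutes_inj)
  have p: "permutation f" using f D by (simp add: permutes_permutation)
  obtain b where b: "f b = e" using f by (metis permutes_def)
  have bD: "b \<in> D" using b D f by (metis permutes_in_image)
  have "b \<in> orbit f e" using b permutation_self_in_orbit[OF p] permutation_preimage_in_orbit[OF p] by metis
  moreover have "e \<noteq> b" using b False by auto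
  moreover have "f \<circ> transpose e b = skip e f"
    using b inj by (auto simp: skip_def fun_eq_iff transpose_def dest: injD)
  ultimately have 1: "card (orbit (skip e f) ` D) = Suc (card (orbit f ` D))"
    using card_orbits_split[OF f D bD] by metis
  have "skip e f permutes D"
    using D f inj by (simp add: skip_eq_comp permutes_compose permutes_swap_id permutes_in_image)
  then have "card (orbit (skip e f) ` D) = Suc (card (orbit (skip e f) ` (D - {e})))"
    by (rule card_orbits_fixpoint[OF _ D]) (simp add: skip_def)
  then show ?thesis using 1 False by simp
qed

locale deletion =
  fixes M :: "'d cmap" and c e
  assumes M: "premap M" and c: "colouring M c" and e: "e \<in> darts M"
begin

abbreviation "N \<equiv> del_edge e M"
abbreviation "e' \<equiv> opp M e"

lemma e': "e' \<in> darts M" "e' \<noteq> e"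
  using e opp_neq[OF M] by (simp_all add: opp_in[OF M])

lemma colours: "c e' = (\<not> c e)" "c (rot M e) = c e" "c (rot M e') = (\<not> c e)"
  using colour_step[OF M c] e e' by auto

lemma rot_neq: "rot M e \<noteq> e'" "rot M e' \<noteq> e"
  using colours by auto

lemma del_rot: "rot N = skip e' (skip e (rot M))"
  using rot_neq e'(2) by (auto simp: del_edge_def skip_def fun_eq_iff)

lemma del_simps: "darts N = darts M - {e, e'}" "x \<notin> {e, e'} \<Longrightarrow> opp N x = opp M x"
  "x \<notin> {e, e'} \<Longrightarrow> rot N x = (if rot M x = e then rot M e else if rot M x = e' then rot M e' else rot M x)"
  by (auto simp: del_edge_def)

lemma del_fnext: 
  assumes "x \<notin> {e, e'}"
  shows "fnext N x = (if fnext M x = e then fnext M e' else if fnext M x = e' then fnext M e else fnext M x)"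
proof -
  have "opp M x \<notin> {e, e'}" using assms opp_flip[OF M, of x] by (auto simp: opp_eq[OF M])
  then show ?thesis using assms by (simp add: fnext_def del_simps opp_opp[OF M])
qed

lemma darts_N: "darts N = darts M - {e} - {e'}"
  by (auto simp: del_simps)

lemma del_premap: "premap N"
  unfolding premap_def
proof (intro conjI ballI)
  show "finite (darts N)" using premap_finite[OF M] by (simp add: del_simps)
  have "skip e' (skip e (rot M)) permutes darts M - {e} - {e'}"
    using e e' by (intro skip_permutes premap_rot[OF M]) auto
  then show "rot N permutes darts N" unfolding del_rot darts_N .
  have "skip e' (skip e (opp M)) permutes darts M - {e} - {e'}"
    using e e' by (intro skip_permutes premap_opp[OF M]) auto
  moreover have "skip e' (skip e (opp M)) = opp N"
  proof
    fix x
    show "skip e' (skip e (opp M)) x = opp N x"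
    proof (cases "x \<in> {e, e'}")
      case True then show ?thesis using e'(2) by (auto simp: skip_def del_edge_def)
    next
      case False
      then have "opp M x \<notin> {e, e'}" using opp_flip[OF M, of x] by (auto simp: opp_eq[OF M])
      then show ?thesis using False by (simp add: skip_def del_edge_def)
    qed
  qed
  ultimately show "opp N permutes darts N" unfolding darts_N by simp
  fix d assume "d \<in> darts N"
  then have d: "d \<in> darts M" "d \<notin> {e, e'}" by (auto simp: del_simps)
  then have "opp M d \<notin> {e, e'}" using opp_flip[OF M, of d] by (auto simp: opp_eq[OF M])
  then show "opp N d \<noteq> d" "opp N (opp N d) = d"
    using d opp_neq[OF M] opp_opp[OF M] by (simp_all add: del_simps)
qed

lemma del_colouring: "colouring N c"
  unfolding colouring_def
proof (intro ballI conjI)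
  fix d assume "d \<in> darts N"
  then have d: "d \<in> darts M" "d \<notin> {e, e'}" by (auto simp: del_simps)
  show "c (opp N d) = (\<not> c d)" using d colour_step[OF M c] by (simp add: del_simps)
  show "c (rot N d) = c d"
    using d colour_step(2)[OF M c d(1)] colours by (auto simp: del_simps)
qed

lemma del_vert:
  assumes "x \<notin> {e, e'}"
  shows "vert N x = vert M x - {e, e'}"
proof -
  have "inj (rot M)" using premap_rot[OF M] by (rule permutes_inj)
  then have "permutation (skip e (rot M))"
    using rot_perm[OF M] by (simp add: skip_eq_comp permutation_compose permutation_swap_id)
  then show ?thesis unfolding vert_def del_rot
    using assms by (simp add: skip_orbit[OF rot_perm[OF M]] skip_orbit) blast
qed

lemma del_vert_eq:
  assumes "x \<notin> {e, e'}" "y \<notin> {e, e'}"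
  shows "vert N x = vert N y \<longleftrightarrow> vert M x = vert M y"
proof -
  have "vert N x = vert N y \<longleftrightarrow> x \<in> vert M y - {e, e'}"
    using vert_eq_iff[OF del_premap] del_vert[OF assms(2)] by metis
  then show ?thesis using assms(1) vert_eq_iff[OF M] by auto
qed

lemma del_card_vertices:
  "card (orbit (rot N) ` darts N) + (if rot M e = e then 1 else 0) + (if rot M e' = e' then 1 else 0)
    = card (orbit (rot M) ` darts M)"
proof -
  have s: "skip e (rot M) permutes darts M - {e}" by (rule skip_permutes[OF premap_rot[OF M] e])
  have "skip e (rot M) e' = e' \<longleftrightarrow> rot M e' = e'" using rot_neq e'(2) by (auto simp: skip_def)
  then show ?thesis
    using card_orbits_skip[OF premap_rot[OF M] premap_finite[OF M] e]
      card_orbits_skip[OF s, of e'] premap_finite[OF M] e'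
    unfolding del_rot darts_N by simp
qed

lemma del_card_darts: "card (darts N) + 2 = card (darts M)"
proof -
  have "card {e, e'} \<le> card (darts M)" using e e' premap_finite[OF M] by (intro card_mono) auto
  then show ?thesis using e e' by (simp add: del_simps card_Diff_subset)
qed

text \<open>An edge that lies on two different faces is not a bridge, since the rest of the boundary walk
  of one of these faces joins its ends.\<close>

lemma del_transitive:
  assumes t: "transitive_map M" and bridge: "rot M e = e \<or> e' \<notin> orbit (fnext M) e"
  shows "transitive_map N"
  unfolding transitive_map_iff_closed
proof (intro allI impI)
  fix X assume X: "closed_in N X \<and> X \<noteq> {}"
  then have XN: "X \<subseteq> darts M - {e, e'}" using closed_in_subset[of N X] by (simp add: del_simps)
  then have avoid: "x \<notin> {e, e'}" if "x \<in> X" for x using that by auto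
  note cl = closed_in_iff[OF del_premap conjunct1[OF X]]
  have join: "rot M a' \<in> X \<Longrightarrow> rot M a \<in> X"
    if a: "a \<in> darts M" "a' = opp M a" "{a, a'} = {e, e'}" "a' \<notin> orbit (fnext M) a" for a a'
  proof (rule ccontr)
    assume 1: "rot M a' \<in> X" and 2: "rot M a \<notin> X"
    have fa: "fnext M a \<in> X" using 1 a(2) by (simp add: fnext_def)
    have fx: "fnext N x = (if fnext M x = a then fnext M a' else if fnext M x = a' then fnext M a else fnext M x)"
      if "x \<in> X" for x
      using del_fnext[OF avoid[OF that]] a(3) e'(2) by (auto simp: doubleton_eq_iff)
    have "orbit (fnext M) (fnext M a) \<subseteq> X \<inter> orbit (fnext M) a"
    proof (rule orbit_subsetI)
      show "fnext M a \<in> X \<inter> orbit (fnext M) a" using fa orbit.base by fast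
      fix y assume y: "y \<in> X \<inter> orbit (fnext M) a"
      have "fnext M y \<noteq> a'" using y a(4) orbit.step by (metis IntD2)
      moreover have "fnext M y \<noteq> a"
      proof
        assume "fnext M y = a"
        then have "fnext M a' \<in> X" using fx[of y] cl(3)[of y] y by auto
        then show False using 2 a(2) by (simp add: fnext_opp[OF M])
      qed
      ultimately show "fnext M y \<in> X \<inter> orbit (fnext M) a"
        using fx[of y] cl(3)[of y] y orbit.step by auto
    qed
    moreover have "a \<in> orbit (fnext M) (fnext M a)"
      using permutation_orbit_step[OF fnext_perm[OF M]] permutation_self_in_orbit[OF fnext_perm[OF M]] by metis
    ultimately have "a \<in> X" by blast
    then show False using avoid a(3) by blast
  qed
  have both: "rot M e = e \<or> (rot M e \<in> X \<longleftrightarrow> rot M e' \<in> X)"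
  proof (cases "rot M e = e")
    case False
    then have b: "e' \<notin> orbit (fnext M) e" using bridge by simp
    then have b': "e \<notin> orbit (fnext M) e'"
      using orbit_swap permutation_self_in_orbit[OF fnext_perm[OF M]] by metis
    have "e = opp M e'" "{e', e} = {e, e'}" using opp_opp[OF M] by auto
    then show ?thesis using join[OF e refl refl b] join[OF e'(1) _ _ b'] by blast
  qed simp
  define Y where "Y = (if rot M e \<in> X \<or> rot M e' \<in> X then X \<union> {e, e'} else X)"
  have "Y = darts M"
  proof (rule transitive_onD[OF t])
    show "Y \<noteq> {}" "Y \<subseteq> darts M" using X XN e e' by (auto simp: Y_def)
    fix y assume y: "y \<in> Y"
    consider "y \<in> X" | "y \<notin> X" "y = e" "rot M e \<in> X \<or> rot M e' \<in> X" | "y \<notin> X" "y = e'" "rot M e \<in> X \<or> rot M e' \<in> X"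
      using y by (auto simp: Y_def split: if_splits)
    then show "rot M y \<in> Y"
    proof cases
      case 1
      then show ?thesis using cl(1)[of y] del_simps(3)[OF avoid[OF 1]]
        by (auto simp: Y_def split: if_splits)
    qed (use both avoid[of e] avoid[of e'] in \<open>auto simp: Y_def\<close>)
    from \<open>y \<in> Y\<close> show "opp M y \<in> Y"
      using cl(2)[of y] avoid[of y] del_simps(2)[of y] opp_opp[OF M]
      by (auto simp: Y_def split: if_splits)
  qed
  then show "X = darts N" using XN by (auto simp: del_simps Y_def split: if_splits)
qed

lemma add_leaf_del:
  assumes leaf: "rot M e = e" and "rot M e' \<noteq> e'"
  shows "add_leaf (rot M e') e' e N = M"
proof (rule cmap.equality)
  show "darts (add_leaf (rot M e') e' e N) = darts M" using e e' by (auto simp: add_leaf_def del_simps)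
  show "opp (add_leaf (rot M e') e' e N) = opp M"
    using e'(2) opp_opp[OF M] by (auto simp: add_leaf_def del_edge_def fun_eq_iff)
  show "rot (add_leaf (rot M e') e' e N) = rot M"
    using e'(2) rot_neq assms rot_eq[OF M]
    by (auto simp: add_leaf_def del_edge_def fun_eq_iff)
qed simp

lemma add_edge_del:
  assumes "rot M e \<noteq> e" "rot M e' \<noteq> e'"
  shows "add_edge (rot M e) (rot M e') e e' N = M"
proof (rule cmap.equality)
  show "darts (add_edge (rot M e) (rot M e') e e' N) = darts M" using e e' by (auto simp: add_edge_def del_simps)
  show "opp (add_edge (rot M e) (rot M e') e e' N) = opp M"
    using e'(2) opp_opp[OF M] by (auto simp: add_edge_def del_edge_def fun_eq_iff)
  show "rot (add_edge (rot M e) (rot M e') e e' N) = rot M"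
    using e'(2) rot_neq assms rot_eq[OF M]
    by (auto simp: add_edge_def del_edge_def fun_eq_iff)
qed simp

end

locale insertion =
  fixes M :: "'d cmap" and c f g n n'
  assumes M: "premap M" and c: "colouring M c" and f: "f \<in> darts M" and g: "g \<in> darts M"
    and cfg: "c f \<noteq> c g" and n: "n \<notin> darts M" "n' \<notin> darts M" "n \<noteq> n'"
begin

abbreviation "N \<equiv> add_edge f g n n' M"

lemma fg: "f \<noteq> g" using cfg by auto

lemma add_simps: "darts N = {n, n'} \<union> darts M" "opp N n = n'" "opp N n' = n" "rot N n = f" "rot N n' = g"
  "x \<in> darts M \<Longrightarrow> opp N x = opp M x"
  "x \<in> darts M \<Longrightarrow> rot N x = (if rot M x = f then n else if rot M x = g then n' else rot M x)"
  using n by (auto simp: add_edge_def)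

lemma add_fnext: "fnext N n = g" "fnext N n' = f"
  "x \<in> darts M \<Longrightarrow> fnext N x = (if fnext M x = f then n else if fnext M x = g then n' else fnext M x)"
  by (auto simp: fnext_def add_simps opp_in[OF M])

lemma add_premap: "premap N"
  unfolding premap_def
proof (intro conjI ballI)
  have out: "opp M x = x" "rot M x = x" if "x \<notin> darts M" for x
    using that premap_opp[OF M] premap_rot[OF M] by (auto dest: permutes_not_in)
  show "finite (darts N)" using premap_finite[OF M] by (simp add: add_simps)
  have oo: "opp N (opp N x) = x" for x
  proof (cases "x \<in> darts M")
    case True
    then have "opp M x \<in> darts M" by (simp add: opp_in[OF M])
    then show ?thesis using True n by (auto simp: add_edge_def opp_opp[OF M])
  next
    case False
    then show ?thesis using n by (auto simp: add_edge_def out)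
  qed
  show oN: "opp N permutes darts N"
    unfolding permutes_def
  proof (intro conjI allI impI)
    show "opp N x = x" if "x \<notin> darts N" for x
      using that out by (auto simp: add_edge_def)
    show "\<exists>!x. opp N x = y" for y by (rule ex1I[of _ "opp N y"]) (use oo in auto)
  qed
  have "rot N = rot M \<circ> transpose (inv (rot M) f) n \<circ> transpose (inv (rot M) g) n'"
  proof
    fix x
    have i: "rot M (inv (rot M) y) = y" for y using premap_rot[OF M] by (simp add: permutes_inverses)
    have r: "rot M x = y \<longleftrightarrow> x = inv (rot M) y" for x y using i rot_eq[OF M] by metis
    have "inv (rot M) f \<in> darts M" "inv (rot M) g \<in> darts M" using i rot_in[OF M] f g by metis+
    moreover have "inv (rot M) f \<noteq> inv (rot M) g" using i fg by metis
    ultimately have ne: "inv (rot M) f \<noteq> n" "inv (rot M) f \<noteq> n'" "inv (rot M) g \<noteq> n" "inv (rot M) g \<noteq> n'"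
      "inv (rot M) f \<noteq> inv (rot M) g" using n by auto
    have nn: "rot M n = n" "rot M n' = n'" using n out by auto
    consider "x = inv (rot M) f" | "x = inv (rot M) g" | "x = n" | "x = n'"
      | "x \<notin> {inv (rot M) f, inv (rot M) g, n, n'}" by blast
    then show "rot N x = (rot M \<circ> transpose (inv (rot M) f) n \<circ> transpose (inv (rot M) g) n') x"
    proof cases
      case 5
      then have "rot M x \<noteq> f" "rot M x \<noteq> g" by (simp_all add: r)
      then show ?thesis using 5 by (simp add: add_edge_def)
    qed (use ne ne[symmetric] n(3) fg fg[symmetric] i nn in \<open>simp_all add: add_edge_def\<close>)
  qed
  moreover have "inv (rot M) f \<in> darts M" "inv (rot M) g \<in> darts M"
    using f g permutes_in_image[OF permutes_inv[OF premap_rot[OF M]]] by auto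
  moreover have "rot M permutes darts N"
    by (rule permutes_subset[OF premap_rot[OF M]]) (auto simp: add_simps)
  ultimately show "rot N permutes darts N"
    by (simp add: permutes_compose permutes_swap_id add_simps)
  fix d assume d: "d \<in> darts N"
  show "opp N (opp N d) = d" by (rule oo)
  show "opp N d \<noteq> d" using d n opp_neq[OF M] by (auto simp: add_edge_def)
qed

lemma add_transitive:
  assumes t: "transitive_map M"
  shows "transitive_map N"
  unfolding transitive_map_iff_closed
proof (intro allI impI)
  fix X assume X: "closed_in N X \<and> X \<noteq> {}"
  note cl = closed_in_iff[OF add_premap conjunct1[OF X]]
  have XN: "X \<subseteq> darts N" using X closed_in_subset by blast
  have nf: "n \<in> X \<longleftrightarrow> f \<in> X" "n' \<in> X \<longleftrightarrow> g \<in> X" "n \<in> X \<longleftrightarrow> n' \<in> X"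
    using cl(1)[of n] cl(1)[of n'] cl(2)[of n] by (auto simp: add_simps)
  have "X \<inter> darts M = darts M"
  proof (rule transitive_onD[OF t])
    show "X \<inter> darts M \<noteq> {}" using X XN nf f by (auto simp: add_simps)
    fix x assume x: "x \<in> X \<inter> darts M"
    show "rot M x \<in> X \<inter> darts M"
      using x cl(1)[of x] add_simps(7)[of x] nf rot_in[OF M, of x] by (auto split: if_splits)
    show "opp M x \<in> X \<inter> darts M"
      using x cl(2)[of x] add_simps(6)[of x] opp_in[OF M, of x] by auto
  qed simp
  then show "X = darts N" using XN nf f by (auto simp: add_simps)
qed

lemma add_colouring: "colouring N (c(n := c f, n' := c g))"
  unfolding colouring_def
proof (intro ballI conjI)
  fix d assume d: "d \<in> darts N"
  note s = colour_step[OF M c]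
  show "(c(n := c f, n' := c g)) (opp N d) = (\<not> (c(n := c f, n' := c g)) d)"
  proof (cases "d \<in> darts M")
    case True
    then have "opp M d \<notin> {n, n'}" "d \<notin> {n, n'}" using n opp_in[OF M, of d] by auto
    then show ?thesis using True s(1)[of d] by (simp add: add_simps)
  next
    case False
    then have "d = n \<or> d = n'" using d by (auto simp: add_simps)
    then show ?thesis using n(3) cfg by (auto simp: add_simps)
  qed
  show "(c(n := c f, n' := c g)) (rot N d) = (c(n := c f, n' := c g)) d"
  proof (cases "d \<in> darts M")
    case True
    then have "rot M d \<notin> {n, n'}" "d \<notin> {n, n'}" using n rot_in[OF M, of d] by auto
    then show ?thesis using True s(2)[of d] n(3) by (auto simp: add_simps)
  next
    case False
    then have "d = n \<or> d = n'" using d by (auto simp: add_simps)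
    moreover have "f \<notin> {n, n'}" "g \<notin> {n, n'}" using f g n by auto
    ultimately show ?thesis using n(3) by (auto simp: add_simps)
  qed
qed

lemma del_add: "del_edge n N = M"
proof (rule cmap.equality)
  have out: "opp M x = x" "rot M x = x" if "x \<notin> darts M" for x
    using that premap_opp[OF M] premap_rot[OF M] by (auto dest: permutes_not_in)
  show "darts (del_edge n N) = darts M" using n by (auto simp: del_edge_def add_edge_def)
  show "opp (del_edge n N) = opp M" using n out by (auto simp: del_edge_def add_edge_def fun_eq_iff)
  show "rot (del_edge n N) = rot M"
  proof
    fix x
    show "rot (del_edge n N) x = rot M x"
    proof (cases "x \<in> darts M")
      case True
      then have "x \<notin> {n, n'}" "rot M x \<notin> {n, n'}" using n rot_in[OF M, of x] by auto
      then show ?thesis using n f g fg by (simp add: del_edge_def add_edge_def)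
    next
      case False
      then have "rot M x \<noteq> f" "rot M x \<noteq> g" using out f g by auto
      then show ?thesis using n out[OF False] by (auto simp: del_edge_def add_edge_def)
    qed
  qed
qed simp

lemma deletion: "deletion N (c(n := c f, n' := c g)) n"
  by unfold_locales (auto simp: add_premap add_colouring add_simps)

end

subsection \<open>Undoing the extensions\<close>

lemma orbit_cycle4:
  assumes "permutation f" "f a = b" "f b = c" "f c = d" "f d = a" "a \<noteq> c" "b \<noteq> d" "x \<in> {a, b, c, d}"
  shows "card (orbit f x) = 4"
  using assms unfolding orbit4_iff[OF assms(1)] by auto

lemma fnext_in_orbit_iff:
  assumes "premap M"
  shows "fnext M x \<in> orbit (fnext M) y \<longleftrightarrow> x \<in> orbit (fnext M) y"
  using permutation_preimage_in_orbit[OF fnext_perm[OF assms]] orbit.step by metis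

locale coloured_quadrangulation =
  fixes M :: "'d cmap" and c
  assumes Q: "plane_quadrangulation M" and c: "colouring M c"
begin

lemma M: "premap M"
  and transitive: "transitive_map M"
  and faces4: "d \<in> darts M \<Longrightarrow> card (orbit (fnext M) d) = 4"
  and vertices: "4 * card (orbit (rot M) ` darts M) = card (darts M) + 8"
  using Q unfolding plane_quadrangulation_iff by auto

lemma fnext4:
  assumes "d \<in> darts M"
  shows "fnext M (fnext M (fnext M (fnext M d))) = d" "fnext M (fnext M d) \<noteq> d"
  using faces4[OF assms] orbit4_iff[OF fnext_perm[OF M]] by auto

lemma orbit_fnext:
  "d \<in> darts M \<Longrightarrow> orbit (fnext M) d = {d, fnext M d, fnext M (fnext M d), fnext M (fnext M (fnext M d))}"
  by (rule orbit_return4) (rule fnext4)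

lemma small:
  assumes "d \<in> darts M" "opp M d = d'" "fnext M d = p" "fnext M p = p'" "opp M p = p'"
    "fnext M p' = d'" "fnext M d' = d"
  shows "card (darts M) \<le> 4"
proof -
  have "{d, d', p, p'} = darts M"
  proof (rule transitive_onD[OF transitive])
    have o: "opp M d' = d" "opp M p' = p" using assms opp_opp[OF M] by metis+
    show "{d, d', p, p'} \<subseteq> darts M" using assms opp_in[OF M] fnext_in[OF M] by blast
    fix x assume x: "x \<in> {d, d', p, p'}"
    then show "opp M x \<in> {d, d', p, p'}" using assms o by auto
    show "rot M x \<in> {d, d', p, p'}" using x assms o fnext_opp[OF M, of x] by auto
  qed simp
  moreover have "card {d, d', p, p'} \<le> 4" by (simp add: card_insert_if)
  ultimately show ?thesis by simp
qed

lemma plane_quadrangulationI: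
  assumes "premap N" "transitive_map N" "U \<subseteq> darts M"
    and U: "\<And>x. fnext M x \<in> U \<longleftrightarrow> x \<in> U"
    and eq: "\<And>x. x \<in> darts N \<Longrightarrow> x \<in> darts M \<Longrightarrow> x \<notin> U \<Longrightarrow> fnext N x = fnext M x"
    and sub: "darts M - U \<subseteq> darts N"
    and rest: "\<And>x. x \<in> darts N \<Longrightarrow> x \<notin> darts M - U \<Longrightarrow> card (orbit (fnext N) x) = 4"
    and card: "4 * card (orbit (rot N) ` darts N) = card (darts N) + 8"
  shows "plane_quadrangulation N"
  unfolding plane_quadrangulation_iff
proof (intro conjI ballI)
  fix d assume d: "d \<in> darts N"
  show "card (orbit (fnext N) d) = 4"
  proof (cases "d \<in> darts M - U")
    case True
    have "orbit (fnext N) d = orbit (fnext M) d"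
    proof (rule orbit_cong0[OF True])
      show "fnext N \<in> darts M - U \<rightarrow> darts M - U"
        using eq sub U fnext_in[OF M] by (auto simp: subset_iff)
    qed (use eq sub in auto)
    then show ?thesis using faces4 True by simp
  qed (use rest d in auto)
qed (use assms in auto)

lemma undo_D1:
  assumes d: "d \<in> darts M" "rot M d = d" and large: "card (darts M) > 4"
  shows "\<exists>N. plane_quadrangulation N \<and> card (darts N) < card (darts M) \<and> ext_D1 N M"
proof -
  define k p where "k = opp M d" and "p = fnext M d"
  define s where "s = fnext M p"
  define e where "e = opp M s"
  note inD = opp_in[OF M] rot_in[OF M] fnext_in[OF M] and col = colour_step[OF M c]
  have D: "k \<in> darts M" "p \<in> darts M" "s \<in> darts M" "e \<in> darts M"
    unfolding k_def p_def s_def e_def using d by (simp_all add: inD)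
  have o: "opp M d = k" "opp M k = d" "opp M s = e" "opp M e = s"
    by (simp_all add: k_def e_def opp_opp[OF M])
  have fk: "fnext M k = d" using d(2) by (simp add: fnext_def o)
  have fs: "fnext M s = k" using fnext4(1)[OF d(1)] fk fnext_eq[OF M] unfolding s_def p_def by metis
  have f: "fnext M d = p" "fnext M p = s" "fnext M s = k" "fnext M k = d"
    using fk fs by (simp_all add: p_def s_def)
  have cc: "c k = (\<not> c d)" "c p = (\<not> c d)" "c s = c d" "c e = (\<not> c d)"
    using col d D by (simp_all add: k_def p_def s_def e_def)
  have cne: "d \<noteq> k" "d \<noteq> p" "d \<noteq> e" "s \<noteq> k" "s \<noteq> p" "s \<noteq> e" using cc by auto
  note cne = cne cne[symmetric]
  have sd: "s \<noteq> d" using fnext4(2)[OF d(1)] by (simp add: f)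
  have kp: "k \<noteq> p" using fnext4(2)[OF D(2)] by (simp add: f)
  have ep: "e \<noteq> p"
  proof
    assume "e = p"
    then have "opp M p = s" using o by simp
    then show False using small[OF d(1) o(1) f(1) f(2) _ f(3,4)] large by simp
  qed
  have ek: "e \<noteq> k" using sd o opp_eq[OF M] by metis
  have od: "orbit (fnext M) d = {d, p, s, k}" using orbit_fnext[OF d(1)] by (simp add: f)
  define e1 where "e1 = fnext M e"
  define e2 where "e2 = fnext M e1"
  define e3 where "e3 = fnext M e2"
  have fe: "fnext M e = e1" "fnext M e1 = e2" "fnext M e2 = e3" "fnext M e3 = e"
    using fnext4(1)[OF D(4)] by (simp_all add: e1_def e2_def e3_def)
  have oe: "orbit (fnext M) e = {e, e1, e2, e3}" using orbit_fnext[OF D(4)] by (simp add: fe)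
  have "e \<notin> orbit (fnext M) d" unfolding od using cne ep ek by auto
  then have "orbit (fnext M) e \<inter> orbit (fnext M) d = {}" by (rule orbit_disjoint[OF fnext_perm[OF M]])
  then have ne: "{e, e1, e2, e3} \<inter> {d, p, s, k} = {}" unfolding od oe .
  have De: "e1 \<in> darts M" "e2 \<in> darts M" "e3 \<in> darts M" unfolding e1_def e2_def e3_def using D by (simp_all add: inD)
  have e_ne: "e1 \<noteq> e" "e2 \<noteq> e" "e3 \<noteq> e" "e1 \<noteq> e3"
    using fnext4(2)[OF D(4)] fnext4(2)[OF De(1)] col(3)[OF D(4)] col(3)[OF De(2)] col(3)[OF De(1)]
    by (auto simp: fe)
  interpret d1: deletion M c d by unfold_locales (rule M c d)+
  let ?Q = "del_edge d M"
  have eQ: "e \<in> darts ?Q" "opp ?Q e = s" using D ne by (auto simp: d1.del_simps o)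
  interpret d2: deletion ?Q c e by unfold_locales (rule d1.del_premap d1.del_colouring eQ)+
  let ?N = "del_edge e ?Q"
  have fQ: "fnext ?Q x = (if fnext M x = k then p else fnext M x)" if "x \<noteq> d" "x \<noteq> k" for x
    using d1.del_fnext[of x] that fnext_eq[OF M, of x k] by (auto simp: o f)
  have Q_val: "fnext ?Q s = p" "fnext ?Q p = s" "fnext ?Q e = e1"
    using fQ[of s] fQ[of p] fQ[of e] ne kp sd cne by (auto simp: f fe)
  have fN: "fnext ?N x = (if fnext ?Q x = e then p else if fnext ?Q x = s then e1 else fnext ?Q x)"
    if "x \<noteq> e" "x \<noteq> s" for x
    using d2.del_fnext[of x] that by (simp add: eQ Q_val)
  have N_val: "fnext ?N p = e1" "fnext ?N e1 = e2" "fnext ?N e2 = e3" "fnext ?N e3 = p"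
    using ne e_ne cne ep by (auto simp add: fN fQ fe Q_val)
  have dN: "darts ?N = darts M - {d, k, e, s}" by (auto simp: d2.del_simps d1.del_simps o eQ)
  have rQ: "rot ?Q e = p" "rot ?Q s = e1"
    using fnext_opp[OF d1.del_premap, of e] fnext_opp[OF d1.del_premap, of s]
      opp_opp[OF d1.del_premap, of e] by (simp_all add: eQ Q_val)
  have "rot M k = p" using fnext_opp[OF M, of k] by (simp add: o f)
  then have add1: "add_leaf p k d ?Q = M" using d1.add_leaf_del[OF d(2)] kp by (simp add: o)
  have add2: "add_edge p (fnext ?N p) e s ?N = ?Q"
    using d2.add_edge_del ep ne by (auto simp: eQ rQ N_val)
  have "plane_quadrangulation ?N"
  proof (rule plane_quadrangulationI[where U = "orbit (fnext M) d \<union> orbit (fnext M) e"])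
    show "premap ?N" by (rule d2.del_premap)
    have "orbit (fnext ?Q) s \<subseteq> {s, p}" by (rule orbit_subsetI) (auto simp: Q_val)
    then have "e \<notin> orbit (fnext ?Q) s" using ep ne by auto
    then have "opp ?Q e \<notin> orbit (fnext ?Q) e"
      unfolding eQ using orbit_swap permutation_self_in_orbit[OF fnext_perm[OF d1.del_premap]] by metis
    then show "transitive_map ?N"
      using d2.del_transitive[OF d1.del_transitive[OF transitive]] d(2) by blast
    show "orbit (fnext M) d \<union> orbit (fnext M) e \<subseteq> darts M" unfolding od oe using d D De by auto
    show "fnext M x \<in> orbit (fnext M) d \<union> orbit (fnext M) e \<longleftrightarrow> x \<in> orbit (fnext M) d \<union> orbit (fnext M) e" for x
      using fnext_in_orbit_iff[OF M] by auto
    show "darts M - (orbit (fnext M) d \<union> orbit (fnext M) e) \<subseteq> darts ?N"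
      unfolding dN od oe by auto
    show "fnext ?N x = fnext M x" if "x \<notin> orbit (fnext M) d \<union> orbit (fnext M) e" for x
    proof -
      have x: "x \<notin> {d, p, s, k, e, e1, e2, e3}" using that unfolding od oe by auto
      have "fnext M x \<notin> orbit (fnext M) d \<union> orbit (fnext M) e"
        using that fnext_in_orbit_iff[OF M] by auto
      then have "fnext M x \<notin> {d, p, s, k, e, e1, e2, e3}" unfolding od oe by auto
      then show ?thesis using x fQ[of x] fN[of x] by auto
    qed
    show "card (orbit (fnext ?N) x) = 4"
      if "x \<in> darts ?N" "x \<notin> darts M - (orbit (fnext M) d \<union> orbit (fnext M) e)" for x
      by (rule orbit_cycle4[OF fnext_perm[OF d2.del_premap] N_val])
        (use that ne e_ne in \<open>auto simp: dN od oe\<close>)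
    have "rot M d = d" "rot M k \<noteq> k" "rot ?Q e \<noteq> e" "rot ?Q s \<noteq> s"
      using d kp ep ne \<open>rot M k = p\<close> by (auto simp: rQ)
    then show "4 * card (orbit (rot ?N) ` darts ?N) = card (darts ?N) + 8"
      using d1.del_card_vertices d2.del_card_vertices d1.del_card_darts d2.del_card_darts vertices
      by (simp add: o eQ)
  qed
  moreover have "ext_D1 ?N M" unfolding ext_D1_def
  proof (intro conjI bexI exI)
    show "plane_quadrangulation ?N" by fact
    show "distinct [e, s, k, d]" using ne cne sd ek by auto
    show "{e, s, k, d} \<inter> darts ?N = {}" unfolding dN by auto
    show "M = add_leaf p k d (add_edge p (fnext ?N p) e s ?N)" unfolding add2 add1 ..
    show "p \<in> darts ?N" unfolding dN using D cne kp ep by auto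
  qed
  moreover have "card (darts ?N) < card (darts M)"
    using d1.del_card_darts d2.del_card_darts by linarith
  ultimately show ?thesis by blast
qed

lemma degree2_fnext_neq:
  assumes d: "d \<in> darts M" "rot M (rot M d) = d" and large: "card (darts M) > 4"
  shows "fnext M d \<noteq> opp M d"
proof
  assume a: "fnext M d = opp M d"
  let ?m = "rot M d"
  have 2: "fnext M (opp M d) = ?m" by (rule fnext_opp[OF M])
  have 3: "fnext M (opp M ?m) = d" using fnext_opp[OF M, of ?m] d by simp
  have "fnext M ?m = opp M ?m"
    using fnext4(1)[OF d(1)] 3 fnext_eq[OF M] unfolding a 2 by metis
  then show False
    using small[of "opp M d" d ?m "opp M ?m"] d 2 3 a large opp_opp[OF M] by (simp add: opp_in[OF M])
qed

lemma undo_P0: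
  assumes d: "d \<in> darts M" "rot M (rot M d) = d" "vert M (opp M d) \<noteq> vert M (opp M (rot M d))"
    and large: "card (darts M) > 4"
  shows "\<exists>N. plane_quadrangulation N \<and> card (darts N) < card (darts M) \<and> ext_P0 N M"
proof -
  define m where "m = rot M d"
  define k l where "k = opp M d" and "l = opp M m"
  define x1 where "x1 = fnext M d"
  define x2 where "x2 = fnext M x1"
  define y1 where "y1 = fnext M m"
  define y2 where "y2 = fnext M y1"
  note inD = opp_in[OF M] rot_in[OF M] fnext_in[OF M] and col = colour_step[OF M c]
  have D: "m \<in> darts M" "k \<in> darts M" "l \<in> darts M" "x1 \<in> darts M" "x2 \<in> darts M" "y1 \<in> darts M" "y2 \<in> darts M"
    unfolding m_def k_def l_def x1_def x2_def y1_def y2_def using d by (simp_all add: inD)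
  have o: "opp M d = k" "opp M k = d" "opp M m = l" "opp M l = m"
    by (simp_all add: k_def l_def opp_opp[OF M])
  have r: "rot M d = m" "rot M m = d" using d by (simp_all add: m_def)
  have fk: "fnext M k = m" "fnext M l = d"
    using fnext_opp[OF M, of d] fnext_opp[OF M, of m] by (simp_all add: o r)
  have fx2: "fnext M x2 = l"
    using fnext4(1)[OF d(1)] fk(2) fnext_eq[OF M] unfolding x2_def x1_def by metis
  have fy2: "fnext M y2 = k"
    using fnext4(1)[OF D(1)] fk(1) fnext_eq[OF M] unfolding y2_def y1_def by metis
  have f: "fnext M d = x1" "fnext M x1 = x2" "fnext M x2 = l" "fnext M l = d"
    "fnext M m = y1" "fnext M y1 = y2" "fnext M y2 = k" "fnext M k = m"
    using fk fx2 fy2 by (simp_all add: x1_def x2_def y1_def y2_def)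
  have cc: "c m = c d" "c k = (\<not> c d)" "c l = (\<not> c d)" "c x1 = (\<not> c d)" "c x2 = c d"
    "c y1 = (\<not> c d)" "c y2 = c d"
    using col d D by (simp_all add: m_def k_def l_def x1_def x2_def y1_def y2_def)
  have "d \<noteq> k" "d \<noteq> l" "d \<noteq> x1" "d \<noteq> y1" "m \<noteq> k" "m \<noteq> l" "m \<noteq> x1" "m \<noteq> y1"
    "x2 \<noteq> k" "x2 \<noteq> l" "x2 \<noteq> x1" "x2 \<noteq> y1" "y2 \<noteq> k" "y2 \<noteq> l" "y2 \<noteq> x1" "y2 \<noteq> y1"
    using cc by auto
  note cne = this this[symmetric]
  have md: "m \<noteq> d" using d(3) by (auto simp: m_def)
  have kl: "k \<noteq> l" using md o by metis
  have x1k: "x1 \<noteq> k" using degree2_fnext_neq[OF d(1,2) large] by (simp add: x1_def k_def)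
  have y1l: "y1 \<noteq> l" using degree2_fnext_neq[of m] D(1) large r by (simp add: y1_def l_def)
  have od: "orbit (fnext M) d = {d, x1, x2, l}" using orbit_fnext[OF d(1)] by (simp add: f)
  have om: "orbit (fnext M) m = {m, y1, y2, k}" using orbit_fnext[OF D(1)] by (simp add: f)
  have "m \<notin> orbit (fnext M) d"
  proof
    assume "m \<in> orbit (fnext M) d"
    then have "m = x2" using md cne by (auto simp: od)
    then have "y1 = l" using f by simp
    then show False using y1l by simp
  qed
  then have "orbit (fnext M) m \<inter> orbit (fnext M) d = {}" by (rule orbit_disjoint[OF fnext_perm[OF M]])
  then have ne: "{m, y1, y2, k} \<inter> {d, x1, x2, l} = {}" unfolding od om .
  have ne2: "x2 \<noteq> d" "x1 \<noteq> l" "y2 \<noteq> m" "y1 \<noteq> k"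
    using fnext4(2)[OF d(1)] fnext4(2)[OF D(4)] fnext4(2)[OF D(1)] fnext4(2)[OF D(6)] by (auto simp: f)
  interpret d1: deletion M c m by unfold_locales (rule M c D)+
  let ?Q = "del_edge m M"
  have dQ: "d \<in> darts ?Q" "opp ?Q d = k" using d D ne md cne by (auto simp: d1.del_simps o)
  interpret d2: deletion ?Q c d by unfold_locales (rule d1.del_premap d1.del_colouring dQ)+
  let ?N = "del_edge d ?Q"
  have fQ: "fnext ?Q x = (if fnext M x = m then d else if fnext M x = l then y1 else fnext M x)"
    if "x \<noteq> m" "x \<noteq> l" for x
    using d1.del_fnext[of x] that by (simp add: o f)
  have Q_val: "fnext ?Q d = x1" "fnext ?Q k = d"
    using fQ[of d] fQ[of k] ne ne2 md kl cne by (auto simp: f)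
  have fN: "fnext ?N x = (if fnext ?Q x = d then d else if fnext ?Q x = k then x1 else fnext ?Q x)"
    if "x \<noteq> d" "x \<noteq> k" for x
    using d2.del_fnext[of x] that by (simp add: dQ Q_val)
  have N_val: "fnext ?N x1 = x2" "fnext ?N x2 = y1" "fnext ?N y1 = y2" "fnext ?N y2 = x1"
    using fN[of x1] fN[of x2] fN[of y1] fN[of y2] fQ[of x1] fQ[of x2] fQ[of y1] fQ[of y2] ne ne2 cne
    by (auto simp: f)
  have dN: "darts ?N = darts M - {d, k, m, l}" by (auto simp: d2.del_simps d1.del_simps o dQ)
  have rd: "rot ?Q d = d"
    using fnext_opp[OF d1.del_premap, of k] opp_opp[OF d1.del_premap, of d] fnext_opp[OF d1.del_premap, of d]
    by (simp add: dQ Q_val)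
  have rk: "rot ?Q k = x1"
    using fnext_opp[OF d1.del_premap, of k] opp_opp[OF d1.del_premap, of d]
    by (simp add: dQ Q_val)
  have rl: "rot M l = y1" using fnext_opp[OF M, of l] by (simp add: o f)
  have add1: "add_edge d y1 m l ?Q = M" using d1.add_edge_del md y1l by (simp add: o r rl)
  have add2: "add_leaf x1 k d ?N = ?Q"
    using d2.add_leaf_del[OF rd] x1k by (simp add: dQ rk)
  have "plane_quadrangulation ?N"
  proof (rule plane_quadrangulationI[where U = "orbit (fnext M) d \<union> orbit (fnext M) m"])
    show "premap ?N" by (rule d2.del_premap)
    have "opp M m \<notin> orbit (fnext M) m" unfolding om o using ne by auto
    then show "transitive_map ?N"
      using d2.del_transitive[OF d1.del_transitive[OF transitive]] rd by blast
    show "orbit (fnext M) d \<union> orbit (fnext M) m \<subseteq> darts M" unfolding od om using d D by auto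
    show "fnext M x \<in> orbit (fnext M) d \<union> orbit (fnext M) m \<longleftrightarrow> x \<in> orbit (fnext M) d \<union> orbit (fnext M) m" for x
      using fnext_in_orbit_iff[OF M] by auto
    show "darts M - (orbit (fnext M) d \<union> orbit (fnext M) m) \<subseteq> darts ?N"
      unfolding dN od om by auto
    show "fnext ?N x = fnext M x" if "x \<notin> orbit (fnext M) d \<union> orbit (fnext M) m" for x
    proof -
      have x: "x \<notin> {d, x1, x2, l, m, y1, y2, k}" using that unfolding od om by auto
      have "fnext M x \<notin> orbit (fnext M) d \<union> orbit (fnext M) m"
        using that fnext_in_orbit_iff[OF M] by auto
      then have "fnext M x \<notin> {d, x1, x2, l, m, y1, y2, k}" unfolding od om by auto
      then show ?thesis using x fQ[of x] fN[of x] by auto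
    qed
    show "card (orbit (fnext ?N) x) = 4"
      if "x \<in> darts ?N" "x \<notin> darts M - (orbit (fnext M) d \<union> orbit (fnext M) m)" for x
      by (rule orbit_cycle4[OF fnext_perm[OF d2.del_premap] N_val])
        (use that ne in \<open>auto simp: dN od om\<close>)
    have "rot M m \<noteq> m" "rot M l \<noteq> l" "rot ?Q d = d" "rot ?Q k \<noteq> k"
      using md y1l x1k by (auto simp: r rl rd rk)
    then show "4 * card (orbit (rot ?N) ` darts ?N) = card (darts ?N) + 8"
      using d1.del_card_vertices d2.del_card_vertices d1.del_card_darts d2.del_card_darts vertices
      by (simp add: o dQ)
  qed
  moreover have "vert ?N x1 \<noteq> vert ?N y1"
  proof -
    have "vert M x1 \<noteq> vert M y1" using d(3) by (simp add: x1_def y1_def m_def vert_fnext[OF M])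
    then show ?thesis
      using d1.del_vert_eq[of x1 y1] d2.del_vert_eq[of x1 y1] ne ne2 cne y1l x1k by (auto simp: o dQ)
  qed
  then have "ext_P0 ?N M" unfolding ext_P0_def Let_def
    using \<open>plane_quadrangulation ?N\<close>
  proof (intro conjI bexI exI)
    show "vert ?N x1 \<noteq> vert ?N (fnext ?N (fnext ?N x1))" unfolding N_val by fact
    show "distinct [k, d, m, l]" using ne kl md cne by auto
    show "{k, d, m, l} \<inter> darts ?N = {}" unfolding dN by auto
    show "M = add_edge d (fnext ?N (fnext ?N x1)) m l (add_leaf x1 k d ?N)"
      unfolding N_val add2 add1 ..
    show "x1 \<in> darts ?N" unfolding dN using D ne ne2 cne x1k by auto
  qed
  moreover have "card (darts ?N) < card (darts M)"
    using d1.del_card_darts d2.del_card_darts by linarith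
  ultimately show ?thesis by blast
qed

end

lemma distinct_shuffle: "distinct [u, v, w, x, y, z] \<Longrightarrow> distinct [u, x, w, z, v, y]"
  by auto

context coloured_quadrangulation
begin

lemma undo_P1:
  assumes d: "d \<in> darts M" "rot M (rot M (rot M d)) = d"
    and six: "distinct (map (vert M) [opp M d, opp M (rot M d), opp M (rot M (rot M d)),
      fnext M (fnext M d), fnext M (fnext M (rot M d)), fnext M (fnext M (rot M (rot M d)))])"
    and fresh: "infinite (UNIV :: 'd set)"
  shows "\<exists>N. plane_quadrangulation N \<and> card (darts N) < card (darts M) \<and> ext_P1 N M"
proof -
  define d1 where "d1 = rot M d"
  define d2 where "d2 = rot M d1"
  define b0 b1 b2 where "b0 = opp M d" and "b1 = opp M d1" and "b2 = opp M d2"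
  define x0 x1 x2 where "x0 = fnext M d" and "x1 = fnext M d1" and "x2 = fnext M d2"
  define y0 y1 y2 where "y0 = fnext M x0" and "y1 = fnext M x1" and "y2 = fnext M x2"
  note inD = opp_in[OF M] rot_in[OF M] fnext_in[OF M] and col = colour_step[OF M c]
  have D: "d1 \<in> darts M" "d2 \<in> darts M" "b0 \<in> darts M" "b1 \<in> darts M" "b2 \<in> darts M"
    "x0 \<in> darts M" "x1 \<in> darts M" "x2 \<in> darts M" "y0 \<in> darts M" "y1 \<in> darts M" "y2 \<in> darts M"
    unfolding d1_def d2_def b0_def b1_def b2_def x0_def x1_def x2_def y0_def y1_def y2_def
    using d by (simp_all add: inD)
  have o: "opp M d = b0" "opp M b0 = d" "opp M d1 = b1" "opp M b1 = d1" "opp M d2 = b2" "opp M b2 = d2"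
    by (simp_all add: b0_def b1_def b2_def opp_opp[OF M])
  have r: "rot M d = d1" "rot M d1 = d2" "rot M d2 = d" using d by (simp_all add: d1_def d2_def)
  have fb: "fnext M b0 = d1" "fnext M b1 = d2" "fnext M b2 = d"
    using fnext_opp[OF M, of d] fnext_opp[OF M, of d1] fnext_opp[OF M, of d2] by (simp_all add: o r)
  have "fnext M y0 = b2" "fnext M y1 = b0" "fnext M y2 = b1"
    using fnext4(1)[OF d(1)] fnext4(1)[OF D(1)] fnext4(1)[OF D(2)] fb fnext_eq[OF M]
    unfolding x0_def x1_def x2_def y0_def y1_def y2_def by metis+
  then have f: "fnext M d = x0" "fnext M x0 = y0" "fnext M y0 = b2" "fnext M b2 = d"
    "fnext M d1 = x1" "fnext M x1 = y1" "fnext M y1 = b0" "fnext M b0 = d1"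
    "fnext M d2 = x2" "fnext M x2 = y2" "fnext M y2 = b1" "fnext M b1 = d2"
    using fb by (simp_all add: x0_def x1_def x2_def y0_def y1_def y2_def)
  have cc: "c d1 = c d" "c d2 = c d" "c b0 = (\<not> c d)" "c b1 = (\<not> c d)" "c b2 = (\<not> c d)"
    "c x0 = (\<not> c d)" "c x1 = (\<not> c d)" "c x2 = (\<not> c d)" "c y0 = c d" "c y1 = c d" "c y2 = c d"
    using col d D
    by (simp_all add: d1_def d2_def b0_def b1_def b2_def x0_def x1_def x2_def y0_def y1_def y2_def)
  have six: "distinct (map (vert M) [b0, b1, b2, y0, y1, y2])"
    using six unfolding r o f .
  have vx: "vert M x0 = vert M b0" "vert M x1 = vert M b1" "vert M x2 = vert M b2"
    using vert_fnext[OF M, of d] vert_fnext[OF M, of d1] vert_fnext[OF M, of d2] by (simp_all add: f o)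
  have oF: "orbit (fnext M) d = {d, x0, y0, b2}" "orbit (fnext M) d1 = {d1, x1, y1, b0}"
    "orbit (fnext M) d2 = {d2, x2, y2, b1}"
    using orbit_fnext[OF d(1)] orbit_fnext[OF D(1)] orbit_fnext[OF D(2)] by (simp_all add: f)
  have bb: "b0 \<noteq> b1" "b1 \<noteq> b2" "b0 \<noteq> b2" using six by auto
  then have dd: "d \<noteq> d1" "d1 \<noteq> d2" "d \<noteq> d2" by (auto simp: b0_def b1_def b2_def)
  have "d1 \<noteq> y0"
  proof
    assume "d1 = y0"
    then have "x1 = b2" using f by simp
    then show False using vx six by auto
  qed
  then have n10: "d1 \<notin> orbit (fnext M) d" unfolding oF using dd cc by auto
  have "d2 \<noteq> y1"
  proof
    assume "d2 = y1"
    then have "x2 = b0" using f by simp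
    then show False using vx six by auto
  qed
  then have n21: "d2 \<notin> orbit (fnext M) d1" unfolding oF using dd cc by auto
  have "d \<noteq> y2"
  proof
    assume "d = y2"
    then have "x0 = b1" using f by simp
    then show False using vx six by auto
  qed
  then have n02: "d \<notin> orbit (fnext M) d2" unfolding oF using dd cc by auto
  note dis = orbit_disjoint[OF fnext_perm[OF M]]
  have ne1: "{d1, x1, y1, b0} \<inter> {d, x0, y0, b2} = {}" using dis[OF n10] unfolding oF .
  have ne2: "{d2, x2, y2, b1} \<inter> {d1, x1, y1, b0} = {}" using dis[OF n21] unfolding oF .
  have ne3: "{d, x0, y0, b2} \<inter> {d2, x2, y2, b1} = {}" using dis[OF n02] unfolding oF .
  have "distinct [d, x0, y0, b2]" "distinct [d1, x1, y1, b0]" "distinct [d2, x2, y2, b1]"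
    using faces4[OF d(1)] faces4[OF D(1)] faces4[OF D(2)] unfolding oF
    by (intro card_distinct; simp)+
  then have "distinct ([d, x0, y0, b2] @ [d1, x1, y1, b0] @ [d2, x2, y2, b1])"
    using ne1 ne2 ne3 unfolding distinct_append by auto
  then have dist: "distinct [d, x0, y0, b2, d1, x1, y1, b0, d2, x2, y2, b1]" by simp
  define U where "U = orbit (fnext M) d \<union> orbit (fnext M) d1 \<union> orbit (fnext M) d2"
  have U: "U = {d, x0, y0, b2, d1, x1, y1, b0, d2, x2, y2, b1}" unfolding U_def oF by auto
  have U_closed: "fnext M x \<in> U \<longleftrightarrow> x \<in> U" for x
    unfolding U_def using fnext_in_orbit_iff[OF M] by auto

  interpret del1: deletion M c d1 by unfold_locales (rule M c D)+
  let ?Q1 = "del_edge d1 M"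
  have dQ1: "d2 \<in> darts ?Q1" "opp ?Q1 d2 = b2" "d \<in> darts ?Q1" "opp ?Q1 d = b0"
    using d D dist by (auto simp: del1.del_simps o)
  interpret del2: deletion ?Q1 c d2 by unfold_locales (rule del1.del_premap del1.del_colouring dQ1)+
  let ?Q2 = "del_edge d2 ?Q1"
  have dQ2: "d \<in> darts ?Q2" "opp ?Q2 d = b0"
    using dQ1 dist by (auto simp: del2.del_simps)
  interpret del3: deletion ?Q2 c d by unfold_locales (rule del2.del_premap del2.del_colouring dQ2)+
  let ?Q3 = "del_edge d ?Q2"

  have f1: "fnext ?Q1 x = (if fnext M x = d1 then d2 else if fnext M x = b1 then x1 else fnext M x)"
    if "x \<noteq> d1" "x \<noteq> b1" for x
    using del1.del_fnext[of x] that by (simp add: o f)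
  have v1: "fnext ?Q1 b2 = d" "fnext ?Q1 d2 = x2"
    using dist by (auto simp: f1 f)
  have f2: "fnext ?Q2 x = (if fnext ?Q1 x = d2 then d else if fnext ?Q1 x = b2 then x2 else fnext ?Q1 x)"
    if "x \<noteq> d2" "x \<noteq> b2" for x
    using del2.del_fnext[of x] that by (simp add: dQ1 v1)
  have v2: "fnext ?Q2 b0 = d" "fnext ?Q2 d = x0"
    using dist by (auto simp: f1 f2 f)
  have f3: "fnext ?Q3 x = (if fnext ?Q2 x = d then d else if fnext ?Q2 x = b0 then x0 else fnext ?Q2 x)"
    if "x \<noteq> d" "x \<noteq> b0" for x
    using del3.del_fnext[of x] that by (simp add: dQ2 v2)
  have d3: "darts ?Q3 = darts M - {d1, b1, d2, b2, d, b0}"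
    by (auto simp: del3.del_simps del2.del_simps del1.del_simps dQ1 dQ2 o)

  have rM: "rot M b1 = x1" using fnext_opp[OF M, of b1] by (simp add: o f)
  have r1: "rot ?Q1 d2 = d" "rot ?Q1 b2 = x2"
    using fnext_opp[OF del1.del_premap, of d2] fnext_opp[OF del1.del_premap, of b2]
      opp_opp[OF del1.del_premap, of d2] by (simp_all add: dQ1 v1)
  have r2: "rot ?Q2 d = d" "rot ?Q2 b0 = x0"
    using fnext_opp[OF del2.del_premap, of d] fnext_opp[OF del2.del_premap, of b0]
      opp_opp[OF del2.del_premap, of d] by (simp_all add: dQ2 v2)
  have add1: "add_edge d2 x1 d1 b1 ?Q1 = M"
    using del1.add_edge_del dist by (auto simp: o r rM)
  have add2: "add_edge d x2 d2 b2 ?Q2 = ?Q1"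
    using del2.add_edge_del dist by (auto simp: dQ1 r1)
  have add3: "add_leaf x0 b0 d ?Q3 = ?Q2"
    using del3.add_leaf_del[OF r2(1)] dist by (auto simp: dQ2 r2)

  obtain n where n: "n \<notin> darts M" using ex_new_if_finite[OF fresh premap_finite[OF M]] by blast
  obtain n' where n': "n' \<notin> insert n (darts M)"
    using ex_new_if_finite[OF fresh, of "insert n (darts M)"] premap_finite[OF M] by auto
  interpret ins: insertion ?Q3 c y0 x1 n n'
  proof
    show "premap ?Q3" by (rule del3.del_premap)
    show "colouring ?Q3 c" by (rule del3.del_colouring)
    show "y0 \<in> darts ?Q3" "x1 \<in> darts ?Q3" unfolding d3 using D dist by auto
    show "c y0 \<noteq> c x1" using cc by simp
    show "n \<notin> darts ?Q3" "n' \<notin> darts ?Q3" "n \<noteq> n'" unfolding d3 using n n' by auto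
  qed
  let ?N = "add_edge y0 x1 n n' ?Q3"
  interpret del4: deletion ?N "c(n := c y0, n' := c x1)" n by (rule ins.deletion)
  have del_n: "del_edge n ?N = ?Q3" by (rule ins.del_add)

  have v3: "fnext ?Q3 x1 = y1" "fnext ?Q3 y1 = x0" "fnext ?Q3 x0 = y0"
    "fnext ?Q3 y0 = x2" "fnext ?Q3 x2 = y2" "fnext ?Q3 y2 = x1"
    using dist by (auto simp: f f1 f2 f3)
  have x3: "x0 \<in> darts ?Q3" "x1 \<in> darts ?Q3" "x2 \<in> darts ?Q3"
    "y0 \<in> darts ?Q3" "y1 \<in> darts ?Q3" "y2 \<in> darts ?Q3" unfolding d3 using D dist by auto
  have N_val: "fnext ?N n = x1" "fnext ?N x1 = y1" "fnext ?N y1 = x0" "fnext ?N x0 = n"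
    and N_val': "fnext ?N n' = y0" "fnext ?N y0 = x2" "fnext ?N x2 = y2" "fnext ?N y2 = n'"
    using x3 dist by (auto simp: ins.add_fnext v3)
  have dN: "darts ?N = {n, n'} \<union> (darts M - {d1, b1, d2, b2, d, b0})"
    by (simp add: ins.add_simps d3)
  have nD: "n \<noteq> x" "n' \<noteq> x" if "x \<in> darts M" for x using that n n' by auto

  have PQ: "plane_quadrangulation ?N"
  proof (rule plane_quadrangulationI[where U = U])
    show "premap ?N" by (rule ins.add_premap)
    have "opp M d1 \<notin> orbit (fnext M) d1" unfolding o oF using dist by auto
    then have t1: "transitive_map ?Q1" using del1.del_transitive[OF transitive] by blast
    have "orbit (fnext ?Q1) b2 \<subseteq> {d, x0, y0, b2}"
      by (rule orbit_subsetI) (use dist in \<open>auto simp: f1 f\<close>)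
    then have "d2 \<notin> orbit (fnext ?Q1) b2" using dist by auto
    then have "opp ?Q1 d2 \<notin> orbit (fnext ?Q1) d2"
      unfolding dQ1 using orbit_swap permutation_self_in_orbit[OF fnext_perm[OF del1.del_premap]] by metis
    then have "transitive_map ?Q2" using del2.del_transitive[OF t1] by blast
    then have "transitive_map ?Q3" using del3.del_transitive r2 by blast
    then show "transitive_map ?N" by (rule ins.add_transitive)
    show "U \<subseteq> darts M" unfolding U using d D by auto
    show "fnext M x \<in> U \<longleftrightarrow> x \<in> U" for x by (rule U_closed)
    show "darts M - U \<subseteq> darts ?N" unfolding dN U by auto
    show "fnext ?N x = fnext M x" if x: "x \<in> darts ?N" "x \<in> darts M" "x \<notin> U" for x
    proof -
      have "fnext M x \<notin> U" using x U_closed by simp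
      moreover have "x \<in> darts ?Q3" unfolding d3 using x U by auto
      ultimately show ?thesis using x(3) unfolding U by (simp add: ins.add_fnext f1 f2 f3)
    qed
    show "card (orbit (fnext ?N) x) = 4" if "x \<in> darts ?N" "x \<notin> darts M - U" for x
    proof -
      have "x \<in> {n, x1, y1, x0} \<or> x \<in> {n', y0, x2, y2}" using that unfolding dN U by auto
      then show ?thesis
      proof
        assume "x \<in> {n, x1, y1, x0}"
        then show ?thesis
          by (rule orbit_cycle4[OF fnext_perm[OF ins.add_premap] N_val, rotated 2])
            (use dist nD(1)[OF D(10)] in auto)
      next
        assume "x \<in> {n', y0, x2, y2}"
        then show ?thesis
          by (rule orbit_cycle4[OF fnext_perm[OF ins.add_premap] N_val', rotated 2])
            (use dist nD(2)[OF D(8)] in auto)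
      qed
    qed
    have "rot M d1 \<noteq> d1" "rot M b1 \<noteq> b1" "rot ?Q1 d2 \<noteq> d2" "rot ?Q1 b2 \<noteq> b2"
        "rot ?Q2 d = d" "rot ?Q2 b0 \<noteq> b0"
      using dist by (auto simp: r rM r1 r2)
    moreover have "rot ?N n \<noteq> n" "rot ?N n' \<noteq> n'"
      using nD[OF D(9)] nD[OF D(7)] by (simp_all add: ins.add_simps not_sym)
    ultimately show "4 * card (orbit (rot ?N) ` darts ?N) = card (darts ?N) + 8"
      using del1.del_card_vertices del2.del_card_vertices del3.del_card_vertices del4.del_card_vertices
        del1.del_card_darts del2.del_card_darts del3.del_card_darts del4.del_card_darts vertices
      by (simp add: o dQ1 dQ2 del_n ins.add_simps(2))
  qed
  have veq: "vert ?N x = vert ?N y \<longleftrightarrow> vert M x = vert M y"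
    if "x \<in> darts ?Q3" "y \<in> darts ?Q3" for x y
  proof -
    have x: "x \<notin> {d1, b1, d2, b2, d, b0, n, n'}" "y \<notin> {d1, b1, d2, b2, d, b0, n, n'}"
      using that n n' unfolding d3 by auto
    then have "vert ?N x = vert ?N y \<longleftrightarrow> vert ?Q3 x = vert ?Q3 y"
      using del4.del_vert_eq[of x y] by (simp add: del_n ins.add_simps(2))
    then show ?thesis
      using x del3.del_vert_eq[of x y] del2.del_vert_eq[of x y] del1.del_vert_eq[of x y]
      by (simp add: o dQ1 dQ2)
  qed
  have distinct_M: "distinct [vert M x0, vert M y0, vert M x2, vert M y2, vert M x1, vert M y1]"
    unfolding vx by (rule distinct_shuffle) (use six in simp)
  have "ext_P1 ?N M" unfolding ext_P1_def Let_def
  proof (intro conjI bexI exI)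
    show "plane_quadrangulation ?N" by (rule PQ)
    show "n \<in> darts ?N" by (simp add: dN)
    show "distinct [b0, d, d2, b2, d1, b1]" using dist by auto
    show "{b0, d, d2, b2, d1, b1} \<inter> darts ?N = {}" unfolding dN using nD d D by auto
    show "M = add_edge d2 (fnext ?N n) d1 b1
        (add_edge d (fnext ?N (fnext ?N (opp ?N n))) d2 b2
          (add_leaf (fnext ?N (fnext ?N (fnext ?N n))) b0 d (del_edge n ?N)))"
      unfolding ins.add_simps N_val N_val' del_n add1 add2 add3 ..
    show "distinct [vert ?N (fnext ?N (fnext ?N (fnext ?N n))), vert ?N (fnext ?N (opp ?N n)),
        vert ?N (fnext ?N (fnext ?N (opp ?N n))), vert ?N (fnext ?N (fnext ?N (fnext ?N (opp ?N n)))),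
        vert ?N (fnext ?N n), vert ?N (fnext ?N (fnext ?N n))]"
      unfolding ins.add_simps N_val N_val'
      using distinct_M veq by (simp add: x3)
  qed
  moreover have "card (darts ?N) < card (darts M)"
    using del1.del_card_darts del2.del_card_darts del3.del_card_darts del4.del_card_darts
    by (simp add: del_n)
  ultimately show ?thesis using PQ by blast
qed

end

lemma reduce:
  fixes M :: "nat cmap"
  assumes Q: "plane_quadrangulation M" and large: "card (darts M) > 4"
  shows "\<exists>N. plane_quadrangulation N \<and> card (darts N) < card (darts M) \<and>
    (\<exists>E\<in>{ext_D1, ext_P0, ext_P1}. E N M)"
proof -
  obtain c where c: "colouring M c" using Q by (rule bipartite)
  interpret coloured_quadrangulation M c by unfold_locales (rule Q c)+
  have "darts M \<noteq> {}" using large by auto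
  then obtain d where d: "d \<in> darts M" "reducible M d" using exists_reducible[OF Q] by blast
  from d(2) consider "rot M d = d"
    | "rot M (rot M d) = d" "vert M (opp M d) \<noteq> vert M (opp M (rot M d))"
    | "rot M (rot M (rot M d)) = d" "distinct (map (vert M) [opp M d, opp M (rot M d), opp M (rot M (rot M d)),
        fnext M (fnext M d), fnext M (fnext M (rot M d)), fnext M (fnext M (rot M (rot M d)))])"
    unfolding reducible_def Let_def by blast
  then show ?thesis
  proof cases
    case 1 then show ?thesis using undo_D1[OF d(1) _ large] by blast
  next
    case 2 then show ?thesis using undo_P0[OF d(1) _ _ large] by blast
  next
    case 3 then show ?thesis using undo_P1[OF d(1) _ _ infinite_UNIV_nat] by blast
  qed
qed

subsection \<open>Isomorphic copies\<close>

lemma plane_quadrangulation_image: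
  assumes Q: "plane_quadrangulation M" and h: "bij_betw h (darts M) (darts N)"
    and opp: "\<And>d. d \<in> darts M \<Longrightarrow> h (opp M d) = opp N (h d)"
    and rot: "\<And>d. d \<in> darts M \<Longrightarrow> h (rot M d) = rot N (h d)"
    and out: "\<And>x. x \<notin> darts N \<Longrightarrow> opp N x = x \<and> rot N x = x"
  shows "plane_quadrangulation N"
proof -
  have M: "premap M" and t: "transitive_map M"
    and F: "\<And>d. d \<in> darts M \<Longrightarrow> card (orbit (fnext M) d) = 4"
    and V: "4 * card (orbit (rot M) ` darts M) = card (darts M) + 8"
    using Q unfolding plane_quadrangulation_iff by auto
  have inj: "inj_on h (darts M)" and im: "darts N = h ` darts M"
    using h by (auto simp: bij_betw_def)
  have fin: "finite (darts N)" using im premap_finite[OF M] by simp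
  note inD = opp_in[OF M] rot_in[OF M] fnext_in[OF M]
  have perm: "g permutes darts N"
    if g: "\<And>d. d \<in> darts M \<Longrightarrow> g (h d) = h (f d)" and f: "f permutes darts M"
      and go: "\<And>x. x \<notin> darts N \<Longrightarrow> g x = x" for f g
  proof (rule bij_imp_permutes[OF _ go])
    have fD: "f d \<in> darts M \<longleftrightarrow> d \<in> darts M" for d using f by (simp add: permutes_in_image)
    have finj: "inj f" using f by (rule permutes_inj)
    have "inj_on g (darts N)"
    proof (rule inj_onI)
      fix x y assume "x \<in> darts N" "y \<in> darts N" and eq: "g x = g y"
      then obtain a b where ab: "a \<in> darts M" "b \<in> darts M" "x = h a" "y = h b" using im by auto
      then have "f a = f b" using eq g fD inj_onD[OF inj, of "f a" "f b"] by simp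
      then show "x = y" using finj ab by (auto dest: injD)
    qed
    moreover have "g ` darts N \<subseteq> darts N" using im g fD by auto
    ultimately show "bij_betw g (darts N) (darts N)"
      using endo_inj_surj[OF fin] by (simp add: bij_betw_def)
  qed
  have N: "premap N" unfolding premap_def
  proof (intro conjI ballI)
    show "finite (darts N)" by (rule fin)
    show "opp N permutes darts N" by (rule perm[OF _ premap_opp[OF M]]) (use opp out in auto)
    show "rot N permutes darts N" by (rule perm[OF _ premap_rot[OF M]]) (use rot out in auto)
    fix x assume "x \<in> darts N"
    then obtain d where d: "d \<in> darts M" "x = h d" using im by auto
    then have "opp N x = h (opp M d)" "opp N (opp N x) = h (opp M (opp M d))"
      using opp[of d] opp[of "opp M d"] by (auto simp: inD)
    then show "opp N x \<noteq> x" "opp N (opp N x) = x"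
      using d opp_neq[OF M d(1)] opp_opp[OF M] inj_onD[OF inj, of "opp M d" d] by (auto simp: inD)
  qed
  have fnext: "fnext N (h d) = h (fnext M d)" if "d \<in> darts M" for d
    using that opp[of d] rot[of "opp M d"] by (simp add: fnext_def inD)
  have orb: "orbit g (h d) = h ` orbit f d"
    if "\<And>d. d \<in> darts M \<Longrightarrow> g (h d) = h (f d)" "f permutes darts M" "d \<in> darts M" for f g d
    by (rule orbit_inverse[symmetric])
      (use that permutation_self_in_orbit[OF permutes_permutation[OF that(2) premap_finite[OF M]]]
        permutes_orbit_subset[OF that(2,3)] in auto)
  have F': "card (orbit (fnext N) x) = 4" if x: "x \<in> darts N" for x
  proof -
    obtain d where d: "d \<in> darts M" "x = h d" using im x by auto
    have "orbit (fnext M) d \<subseteq> darts M" by (rule permutes_orbit_subset[OF fnext_permutes[OF M] d(1)])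
    then show ?thesis
      using F[OF d(1)] orb[OF fnext fnext_permutes[OF M] d(1)] card_image[OF inj_on_subset[OF inj]] d(2)
      by metis
  qed
  have "orbit (rot N) ` darts N = (`) h ` (orbit (rot M) ` darts M)"
    unfolding im image_image
    by (rule image_cong[OF refl]) (use orb[OF _ premap_rot[OF M]] rot in auto)
  moreover have "inj_on ((`) h) (orbit (rot M) ` darts M)"
    by (rule inj_on_subset[OF inj_on_image_Pow[OF inj]]) (use permutes_orbit_subset[OF premap_rot[OF M]] in auto)
  ultimately have V': "card (orbit (rot N) ` darts N) = card (orbit (rot M) ` darts M)"
    by (simp add: card_image)
  have "transitive_map N"
  proof (rule transitive_onI)
    fix X assume X: "X \<noteq> {}" "X \<subseteq> darts N" "\<And>x. x \<in> X \<Longrightarrow> rot N x \<in> X" "\<And>x. x \<in> X \<Longrightarrow> opp N x \<in> X"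
    have "{d \<in> darts M. h d \<in> X} = darts M"
      by (rule transitive_onD[OF t]) (use X im opp rot inD in auto)
    then show "X = darts N" using X(2) im by auto
  qed
  then show ?thesis unfolding plane_quadrangulation_iff
    using N F' V V' bij_betw_same_card[OF h] by simp
qed

lemma nat_copy:
  assumes Q: "plane_quadrangulation (M :: 'e cmap)"
  obtains N :: "nat cmap" and h where "plane_quadrangulation N" "bij_betw h (darts N) (darts M)"
    "\<And>d. d \<in> darts N \<Longrightarrow> h (opp N d) = opp M (h d)" "\<And>d. d \<in> darts N \<Longrightarrow> h (rot N d) = rot M (h d)"
proof -
  have M: "premap M" using Q unfolding plane_quadrangulation_iff by simp
  obtain i :: "'e \<Rightarrow> nat" where i: "inj_on i (darts M)"
    using finite_imp_inj_to_nat_seg[OF premap_finite[OF M]] by blast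
  define h where "h = inv_into (darts M) i"
  define N where "N = \<lparr>darts = i ` darts M,
    opp = (\<lambda>n. if n \<in> i ` darts M then i (opp M (h n)) else n),
    rot = (\<lambda>n. if n \<in> i ` darts M then i (rot M (h n)) else n)\<rparr>"
  have hi: "h (i d) = d" if "d \<in> darts M" for d using i that by (simp add: h_def)
  show ?thesis
  proof (rule that)
    show "plane_quadrangulation N"
      by (rule plane_quadrangulation_image[OF Q, of i])
        (use i in \<open>auto simp: N_def hi bij_betw_def\<close>)
    show "bij_betw h (darts N) (darts M)"
      using inj_on_imp_bij_betw[OF i] by (simp add: h_def N_def bij_betw_inv_into)
    show "h (opp N d) = opp M (h d)" "h (rot N d) = rot M (h d)" if "d \<in> darts N" for d
      using that by (auto simp: N_def hi opp_in[OF M] rot_in[OF M])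
  qed
qed

definition relabel :: "('d \<Rightarrow> 'd) \<Rightarrow> 'd cmap \<Rightarrow> 'd cmap" where
  "relabel p M = \<lparr>darts = p ` darts M, opp = p \<circ> opp M \<circ> inv p, rot = p \<circ> rot M \<circ> inv p\<rparr>"

context
  fixes p :: "'d \<Rightarrow> 'd"
  assumes p: "bij p"
begin

lemma p_eq: "p a = p b \<longleftrightarrow> a = b" "inv p (p a) = a"
  using bij_is_inj[OF p] by (auto dest: injD)

lemma p_fun_eqI: "(\<And>x. f (p x) = g (p x)) \<Longrightarrow> f = g"
  using bij_is_surj[OF p] by (metis ext surjD)

lemma relabel_simps: "darts (relabel p M) = p ` darts M" "opp (relabel p M) (p x) = p (opp M x)"
  "rot (relabel p M) (p x) = p (rot M x)" "fnext (relabel p M) (p x) = p (fnext M x)"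
  by (simp_all add: relabel_def fnext_def p_eq)

lemma relabel_in: "p x \<in> darts (relabel p M) \<longleftrightarrow> x \<in> darts M"
  by (auto simp: relabel_simps p_eq)

lemma relabel_add_leaf: "relabel p (add_leaf f d d' M) = add_leaf (p f) (p d) (p d') (relabel p M)"
  by (rule cmap.equality)
    (auto intro!: p_fun_eqI simp: relabel_simps add_leaf_def relabel_def p_eq)

lemma relabel_add_edge: "relabel p (add_edge f g d d' M) = add_edge (p f) (p g) (p d) (p d') (relabel p M)"
  by (rule cmap.equality)
    (auto intro!: p_fun_eqI simp: relabel_simps add_edge_def relabel_def p_eq)

lemma relabel_del_edge: "relabel p (del_edge e M) = del_edge (p e) (relabel p M)"
  by (rule cmap.equality)
    (auto intro!: p_fun_eqI simp: relabel_simps del_edge_def relabel_def p_eq)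

lemma relabel_plane_quadrangulation:
  assumes Q: "plane_quadrangulation M"
  shows "plane_quadrangulation (relabel p M)"
proof (rule plane_quadrangulation_image[OF Q])
  have M: "premap M" using Q unfolding plane_quadrangulation_iff by simp
  show "bij_betw p (darts M) (darts (relabel p M))"
    using p by (simp add: relabel_simps bij_betw_def inj_on_def p_eq)
  fix x assume x: "x \<notin> darts (relabel p M)"
  obtain y where "x = p y" using bij_is_surj[OF p] by blast
  then show "opp (relabel p M) x = x \<and> rot (relabel p M) x = x"
    using x premap_opp[OF M] premap_rot[OF M]
    by (auto simp: relabel_in relabel_simps(2-) permutes_not_in)
qed (simp_all add: relabel_simps)

lemma relabel_vert:
  assumes "premap M"
  shows "vert (relabel p M) (p x) = p ` vert M x"
  unfolding vert_def
  by (rule orbit_inverse[symmetric])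
    (use permutation_self_in_orbit[OF rot_perm[OF assms]] relabel_simps in auto)

lemma relabel_vert_eq:
  assumes "premap M"
  shows "vert (relabel p M) (p x) = vert (relabel p M) (p y) \<longleftrightarrow> vert M x = vert M y"
  using inj_image_eq_iff[OF bij_is_inj[OF p]] by (simp add: relabel_vert[OF assms])

lemma relabel_disjoint: "p ` A \<inter> darts (relabel p M) = {} \<longleftrightarrow> A \<inter> darts M = {}"
  by (auto simp: relabel_simps p_eq)

lemma relabel_ext_D1:
  assumes "ext_D1 M N"
  shows "ext_D1 (relabel p M) (relabel p N)"
proof -
  obtain q d d' k k' where q: "plane_quadrangulation M" "q \<in> darts M" "distinct [d, d', k, k']"
    "{d, d', k, k'} \<inter> darts M = {}" "N = add_leaf q k k' (add_edge q (fnext M q) d d' M)"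
    using assms unfolding ext_D1_def by blast
  show ?thesis unfolding ext_D1_def
  proof (intro conjI bexI exI)
    show "plane_quadrangulation (relabel p M)" using q(1) by (rule relabel_plane_quadrangulation)
    show "p q \<in> darts (relabel p M)" using q(2) by (simp add: relabel_in)
    show "distinct [p d, p d', p k, p k']" using q(3) by (simp add: p_eq)
    show "{p d, p d', p k, p k'} \<inter> darts (relabel p M) = {}"
      using q(4) relabel_disjoint[of "{d, d', k, k'}" M] by simp
    show "relabel p N = add_leaf (p q) (p k) (p k')
        (add_edge (p q) (fnext (relabel p M) (p q)) (p d) (p d') (relabel p M))"
      unfolding q(5) relabel_add_leaf relabel_add_edge relabel_simps ..
  qed
qed

lemma relabel_ext_P0:
  assumes "ext_P0 M N"
  shows "ext_P0 (relabel p M) (relabel p N)"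
proof -
  obtain f k k' l l' where q: "plane_quadrangulation M" "f \<in> darts M"
    "vert M f \<noteq> vert M (fnext M (fnext M f))" "distinct [k, k', l, l']"
    "{k, k', l, l'} \<inter> darts M = {}" "N = add_edge k' (fnext M (fnext M f)) l l' (add_leaf f k k' M)"
    using assms unfolding ext_P0_def Let_def by blast
  have M: "premap M" using q(1) unfolding plane_quadrangulation_iff by simp
  show ?thesis unfolding ext_P0_def Let_def
  proof (intro conjI bexI exI)
    show "plane_quadrangulation (relabel p M)" using q(1) by (rule relabel_plane_quadrangulation)
    show "p f \<in> darts (relabel p M)" using q(2) by (simp add: relabel_in)
    show "vert (relabel p M) (p f) \<noteq> vert (relabel p M) (fnext (relabel p M) (fnext (relabel p M) (p f)))"
      using q(3) by (simp add: relabel_simps relabel_vert_eq[OF M])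
    show "distinct [p k, p k', p l, p l']" using q(4) by (simp add: p_eq)
    show "{p k, p k', p l, p l'} \<inter> darts (relabel p M) = {}"
      using q(5) relabel_disjoint[of "{k, k', l, l'}" M] by simp
    show "relabel p N = add_edge (p k') (fnext (relabel p M) (fnext (relabel p M) (p f))) (p l) (p l')
        (add_leaf (p f) (p k) (p k') (relabel p M))"
      unfolding q(6) relabel_add_leaf relabel_add_edge relabel_simps ..
  qed
qed

lemma relabel_ext_P1:
  assumes "ext_P1 M N"
  shows "ext_P1 (relabel p M) (relabel p N)"
proof -
  obtain xc k k' l l' m m' where q: "plane_quadrangulation M" "xc \<in> darts M"
    "distinct [k, k', l, l', m, m']" "{k, k', l, l', m, m'} \<inter> darts M = {}"
    "distinct (map (vert M) [fnext M (fnext M (fnext M xc)), fnext M (opp M xc),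
        fnext M (fnext M (opp M xc)), fnext M (fnext M (fnext M (opp M xc))),
        fnext M xc, fnext M (fnext M xc)])"
    "N = add_edge l (fnext M xc) m m'
        (add_edge k' (fnext M (fnext M (opp M xc))) l l'
          (add_leaf (fnext M (fnext M (fnext M xc))) k k' (del_edge xc M)))"
    using assms unfolding ext_P1_def Let_def list.map by blast
  have M: "premap M" using q(1) unfolding plane_quadrangulation_iff by simp
  let ?R = "relabel p M"
  have dist: "distinct (map (vert ?R) (map p xs)) \<longleftrightarrow> distinct (map (vert M) xs)" for xs
    by (induction xs) (auto simp: relabel_vert_eq[OF M] image_iff)
  show ?thesis unfolding ext_P1_def Let_def
  proof (intro conjI bexI exI)
    show "plane_quadrangulation ?R" using q(1) by (rule relabel_plane_quadrangulation)
    show "p xc \<in> darts ?R" using q(2) by (simp add: relabel_in)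
    show "distinct [p k, p k', p l, p l', p m, p m']" using q(3) by (simp add: p_eq)
    show "{p k, p k', p l, p l', p m, p m'} \<inter> darts ?R = {}"
      using q(4) relabel_disjoint[of "{k, k', l, l', m, m'}" M] by simp
    show "distinct [vert ?R (fnext ?R (fnext ?R (fnext ?R (p xc)))), vert ?R (fnext ?R (opp ?R (p xc))),
        vert ?R (fnext ?R (fnext ?R (opp ?R (p xc)))), vert ?R (fnext ?R (fnext ?R (fnext ?R (opp ?R (p xc))))),
        vert ?R (fnext ?R (p xc)), vert ?R (fnext ?R (fnext ?R (p xc)))]"
      using q(5)[folded dist] unfolding list.map relabel_simps .
    show "relabel p N = add_edge (p l) (fnext ?R (p xc)) (p m) (p m')
        (add_edge (p k') (fnext ?R (fnext ?R (opp ?R (p xc)))) (p l) (p l')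
          (add_leaf (fnext ?R (fnext ?R (fnext ?R (p xc)))) (p k) (p k') (del_edge (p xc) ?R)))"
      unfolding q(6) relabel_add_leaf relabel_add_edge relabel_del_edge relabel_simps ..
  qed
qed

lemma relabel_steps:
  assumes "(\<lambda>X Y. \<exists>E\<in>{ext_D1, ext_P0, ext_P1}. E X Y)\<^sup>*\<^sup>* M N"
  shows "(\<lambda>X Y. \<exists>E\<in>{ext_D1, ext_P0, ext_P1}. E X Y)\<^sup>*\<^sup>* (relabel p M) (relabel p N)"
  using assms
proof induction
  case (step N N')
  then obtain E where E: "E \<in> {ext_D1, ext_P0, ext_P1}" "E N N'" by (elim bexE)
  then have "E (relabel p N) (relabel p N')"
    using relabel_ext_D1 relabel_ext_P0 relabel_ext_P1 by auto
  then have "\<exists>E\<in>{ext_D1, ext_P0, ext_P1}. E (relabel p N) (relabel p N')" using E(1) by (rule bexI)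
  with step.IH show ?case by (rule rtranclp.rtrancl_into_rtrancl)
qed simp

end

lemma bij_extension:
  assumes h: "bij_betw h A B" and A: "finite A"
  obtains p :: "'a \<Rightarrow> 'a" where "bij p" "\<And>x. x \<in> A \<Longrightarrow> p x = h x"
proof -
  have B: "finite B" "card A = card B" using h A bij_betw_finite bij_betw_same_card by auto
  then have "card (B - A) = card (A - B)"
    using A by (metis card_Diff_subset_Int finite_Int inf_commute)
  then obtain g where g: "bij_betw g (B - A) (A - B)"
    using A B finite_same_card_bij[of "B - A" "A - B"] by auto
  define p where "p = (\<lambda>x. if x \<in> A then h x else if x \<in> B then g x else x)"
  have "bij_betw p A B" using h by (rule bij_betw_cong[THEN iffD1, rotated]) (simp add: p_def)
  moreover have "bij_betw p (B - A) (A - B)"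
    using g by (rule bij_betw_cong[THEN iffD1, rotated]) (simp add: p_def)
  ultimately have "bij_betw p (A \<union> (B - A)) (B \<union> (A - B))" by (rule bij_betw_combine) auto
  moreover have "bij_betw p (- (A \<union> B)) (- (A \<union> B))"
    by (rule bij_betw_cong[THEN iffD1, OF _ bij_betw_id]) (simp add: p_def)
  moreover have "A \<union> (B - A) = A \<union> B" "B \<union> (A - B) = A \<union> B" by auto
  ultimately have "bij_betw p ((A \<union> B) \<union> - (A \<union> B)) ((A \<union> B) \<union> - (A \<union> B))"
    using bij_betw_combine[of p "A \<union> B" "A \<union> B" "- (A \<union> B)" "- (A \<union> B)"]
    by (simp only: Compl_disjoint simp_thms)
  then have "bij p" by (simp only: Compl_partition)
  then show ?thesis by (rule that) (simp add: p_def)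
qed

lemma relabel_path3:
  assumes Q: "plane_quadrangulation B" and card: "card (darts B) \<le> 4"
  obtains p where "bij p" "relabel p B = path3"
proof -
  obtain c where c: "colouring B c" using Q by (rule bipartite)
  interpret coloured_quadrangulation B c by unfold_locales (rule Q c)+
  note inD = opp_in[OF M] rot_in[OF M] fnext_in[OF M] and col = colour_step[OF M c]
  have "darts B \<noteq> {}" using vertices by auto
  then obtain a where a: "a \<in> darts B" by blast
  have "orbit (fnext B) x = darts B" if "x \<in> darts B" for x
    using card faces4[OF that] permutes_orbit_subset[OF fnext_permutes[OF M] that] premap_finite[OF M]
    by (intro card_seteq) auto
  then have D: "darts B = {x, fnext B x, fnext B (fnext B x), fnext B (fnext B (fnext B x))}"
    if "x \<in> darts B" for x using orbit_fnext[OF that] that by simp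
  obtain d where d: "d \<in> darts B" "opp B d = fnext B d"
  proof -
    have "opp B a \<in> {a, fnext B a, fnext B (fnext B a), fnext B (fnext B (fnext B a))}"
      using D[OF a] a inD by blast
    moreover have "opp B a \<noteq> a" "opp B a \<noteq> fnext B (fnext B a)"
      using opp_neq[OF M a] col[OF a] col[of "fnext B a"] a by (auto simp: inD)
    ultimately consider "opp B a = fnext B a" | "opp B a = fnext B (fnext B (fnext B a))" by blast
    then show ?thesis
    proof cases
      case 1 then show ?thesis using that a by blast
    next
      case 2
      then have "fnext B (opp B a) = a" using fnext4(1)[OF a] by simp
      then show ?thesis using that[of "opp B a"] a opp_opp[OF M] by (simp add: inD)
    qed
  qed
  define x y z where "x = fnext B d" and "y = fnext B x" and "z = fnext B y"
  have f: "fnext B d = x" "fnext B x = y" "fnext B y = z" "fnext B z = d"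
    using fnext4(1)[OF d(1)] by (simp_all add: x_def y_def z_def)
  have D: "darts B = {d, x, y, z}" using D[OF d(1)] by (simp add: f)
  have "card {d, x, y, z} = 4" using faces4[OF d(1)] orbit_fnext[OF d(1)] by (simp add: f)
  then have dist: "distinct [d, x, y, z]" by (intro card_distinct) simp
  have o: "opp B d = x" "opp B x = d" using d opp_opp[OF M, of d] by (simp_all add: f)
  have "opp B y \<in> {d, x, y, z}" using inD(1)[of y] D by auto
  moreover have "opp B y \<noteq> d" "opp B y \<noteq> x" "opp B y \<noteq> y"
    using opp_flip[OF M, of y] o dist opp_neq[OF M, of y] D by auto
  ultimately have oy: "opp B y = z" by auto
  then have oz: "opp B z = y" using opp_opp[OF M, of y] by simp
  have r: "rot B d = y" "rot B x = x" "rot B y = d" "rot B z = z"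
    unfolding fnext_opp[OF M, symmetric] by (simp_all add: o oy oz f)
  define h where "h = (\<lambda>u. if u = d then 1 else if u = x then 0 else if u = y then 2 else 3 :: nat)"
  have h: "h d = 1" "h x = 0" "h y = 2" "h z = 3" using dist by (auto simp: h_def)
  have "bij_betw h (darts B) {0, 1, 2, 3}"
    unfolding bij_betw_def D by (auto simp: h inj_on_def)
  then obtain p where p: "bij p" "\<And>u. u \<in> darts B \<Longrightarrow> p u = h u"
    using bij_extension premap_finite[OF M] by metis
  have pv: "p d = 1" "p x = 0" "p y = 2" "p z = 3" using p(2) h by (simp_all add: D)
  note rs = relabel_simps[OF p(1)]
  have eq: "g = g'" if "\<And>u. u \<notin> darts B \<Longrightarrow> g (p u) = p u \<and> g' (p u) = p u"
    "\<And>u. u \<in> darts B \<Longrightarrow> g (p u) = g' (p u)" for g g' :: "nat \<Rightarrow> nat"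
    by (rule p_fun_eqI[OF p(1)]) (metis that)
  have out: "p u \<notin> {0, 1, 2, 3}" if "u \<notin> darts B" for u
    using that p_eq(1)[OF p(1), of u] pv unfolding D by (metis empty_iff insert_iff)
  have "relabel p B = path3"
  proof (rule cmap.equality)
    show "darts (relabel p B) = darts path3" unfolding rs D by (auto simp: pv path3_def)
    show "opp (relabel p B) = opp path3"
    proof (rule eq)
      fix u
      show "opp (relabel p B) (p u) = p u \<and> opp path3 (p u) = p u" if "u \<notin> darts B"
        using out[OF that] that premap_opp[OF M]
        by (auto simp: rs path3_def permutes_not_in transpose_def)
      show "opp (relabel p B) (p u) = opp path3 (p u)" if "u \<in> darts B"
        using that unfolding D by (auto simp: rs o oy oz pv path3_def transpose_def)
    qed
    show "rot (relabel p B) = rot path3"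
    proof (rule eq)
      fix u
      show "rot (relabel p B) (p u) = p u \<and> rot path3 (p u) = p u" if "u \<notin> darts B"
        using out[OF that] that premap_rot[OF M]
        by (auto simp: rs path3_def permutes_not_in transpose_def)
      show "rot (relabel p B) (p u) = rot path3 (p u)" if "u \<in> darts B"
        using that unfolding D by (auto simp: rs r pv path3_def transpose_def)
    qed
  qed simp
  with p(1) show ?thesis by (rule that)
qed

lemma reduce_to_base:
  fixes M :: "nat cmap"
  assumes "plane_quadrangulation M"
  shows "\<exists>B. plane_quadrangulation B \<and> card (darts B) \<le> 4 \<and>
    (\<lambda>X Y. \<exists>E\<in>{ext_D1, ext_P0, ext_P1}. E X Y)\<^sup>*\<^sup>* B M"
  using assms
proof (induction "card (darts M)" arbitrary: M rule: less_induct)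
  case less
  show ?case
  proof (cases "card (darts M) \<le> 4")
    case True
    then show ?thesis using less.prems by blast
  next
    case False
    then obtain N where N: "plane_quadrangulation N" "card (darts N) < card (darts M)"
      "\<exists>E\<in>{ext_D1, ext_P0, ext_P1}. E N M"
      using reduce[OF less.prems] by auto
    from less.hyps[OF N(2,1)] obtain B where B: "plane_quadrangulation B" "card (darts B) \<le> 4"
      "(\<lambda>X Y. \<exists>E\<in>{ext_D1, ext_P0, ext_P1}. E X Y)\<^sup>*\<^sup>* B N" by blast
    from rtranclp.rtrancl_into_rtrancl[OF B(3) N(3)] B(1,2) show ?thesis by blast
  qed
qed

theorem theorem4:
  shows "generates {ext_D1, ext_P0, ext_P1} {path3}
           {Q :: 'd cmap. plane_quadrangulation Q}"
  unfolding generates_def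
proof (intro ballI)
  fix M :: "'d cmap" assume "M \<in> {Q. plane_quadrangulation Q}"
  then have "plane_quadrangulation M" by simp
  then obtain N :: "nat cmap" and h where N: "plane_quadrangulation N"
    and h: "bij_betw h (darts N) (darts M)"
      "\<And>d. d \<in> darts N \<Longrightarrow> h (opp N d) = opp M (h d)" "\<And>d. d \<in> darts N \<Longrightarrow> h (rot N d) = rot M (h d)"
    using nat_copy by blast
  obtain B where B: "plane_quadrangulation B" "card (darts B) \<le> 4"
    "(\<lambda>X Y. \<exists>E\<in>{ext_D1, ext_P0, ext_P1}. E X Y)\<^sup>*\<^sup>* B N"
    using reduce_to_base[OF N] by blast
  obtain p where p: "bij p" "relabel p B = path3" using relabel_path3[OF B(1,2)] .
  have "(\<lambda>X Y. \<exists>E\<in>{ext_D1, ext_P0, ext_P1}. E X Y)\<^sup>*\<^sup>* path3 (relabel p N)"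
    using relabel_steps[OF p(1) B(3)] unfolding p(2) .
  moreover have "map_iso (relabel p N) M" unfolding map_iso_def
  proof (intro exI conjI ballI)
    have "bij_betw (inv p) (darts (relabel p N)) (darts N)"
      using p(1) by (intro bij_betw_byWitness[where f' = p])
        (auto simp: relabel_simps[OF p(1)] p_eq[OF p(1)])
    then show "bij_betw (h \<circ> inv p) (darts (relabel p N)) (darts M)"
      using h(1) by (rule bij_betw_trans)
    fix d assume "d \<in> darts (relabel p N)"
    then obtain u where u: "d = p u" "u \<in> darts N" by (auto simp: relabel_simps[OF p(1)])
    then show "(h \<circ> inv p) (opp (relabel p N) d) = opp M ((h \<circ> inv p) d)"
      "(h \<circ> inv p) (rot (relabel p N) d) = rot M ((h \<circ> inv p) d)"
      using h(2,3)[OF u(2)] by (simp_all add: relabel_simps[OF p(1)] p_eq[OF p(1)])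
  qed
  ultimately show "\<exists>B\<in>{path3}. \<exists>N. (\<lambda>X Y. \<exists>E\<in>{ext_D1, ext_P0, ext_P1}. E X Y)\<^sup>*\<^sup>* B N \<and> map_iso N M"
    by blast
qed

end
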